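(* Let $\alpha\ge 0$. The functional $E_\alpha\colon\mathcal{D}^1(\mathcal{M})\to\mathbb{R}$, $E_\alpha(S)=\int_{\mathcal{M}}\|DS(x)\|^2-\alpha\|S(x)\|^2\,dx$, is bounded from below: $$E_\alpha(S)\ge-\alpha\operatorname{Vol}(\mathcal{M})>-\infty,\qquad\forall S\in\mathcal{D}^1(\mathcal{M}).$$ This lower bound is attained, and the set of minimizers is $$\operatorname*{arg\,min}_{S\in\mathcal{D}^1(\mathcal{M})}E_\alpha(S)=\begin{cases}\{S_{e_1},\dots,S_{e_c}\},&\text{if }\alpha>0,\\ \{S_p\colon\mathcal{M}\to\Delta_c : p\in\Delta_c\},&\text{if }\alpha=0,\end{cases}$$ where, for any $p\in\Delta_c$, $S_p$ denotes the constant vector field $x\mapsto S_p(x)=p$ (functions being identified when equal almost everywhere).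
   Context: $\mathcal{M}\subset\mathbb{R}^2$ is a simply-connected bounded open set with Lebesgue measure $\operatorname{Vol}(\mathcal{M})$, $c\in\mathbb{N}$, $c\ge 2$. $\Delta_c=\{p\in\mathbb{R}^c: p_j\ge 0\ \forall j,\ \sum_{j}p_j=1\}$ is the probability simplex and $e_1,\dots,e_c$ is the standard basis of $\mathbb{R}^c$. $H^1(\mathcal{M};\mathbb{R}^c)$ is the Sobolev space of vector-valued functions with components in $H^1(\mathcal{M})=W^{1,2}(\mathcal{M})$. $DS$ is the weak derivative (Jacobian) of $S$, $\|DS(x)\|$ its Frobenius norm and $\|S(x)\|$ the Euclidean norm. $\mathcal{D}^1(\mathcal{M})=\{S\in H^1(\mathcal{M};\mathbb{R}^c): S(x)\in\Delta_c\text{ for a.e. }x\in\mathcal{M}\}$. *)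

theory Defs
  imports "HOL-Analysis.Analysis"
begin

text \<open>A function is of class \<open>C\<^sup>k\<close> on the whole space iff all its iterated partial derivatives
  up to order \<open>k\<close> exist as derivatives of Frechet-differentiable functions and are continuous.\<close>

fun C_k :: "nat \<Rightarrow> ('a::euclidean_space \<Rightarrow> real) \<Rightarrow> bool" where
  "C_k 0 f \<longleftrightarrow> continuous_on UNIV f"
| "C_k (Suc k) f \<longleftrightarrow> (\<forall>x. f differentiable (at x)) \<and>
     (\<forall>b\<in>Basis. C_k k (\<lambda>x. frechet_derivative f (at x) b))"

text \<open>\<open>C\<^sub>c\<^sup>\<infinity>(M)\<close>, for open \<open>M\<close>; test functions are extended by zero to the whole space.\<close>

definition test_functions :: "'a::euclidean_space set \<Rightarrow> ('a \<Rightarrow> real) set" where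
  "test_functions M = {\<phi>. (\<forall>k. C_k k \<phi>) \<and> compact (closure {x. \<phi> x \<noteq> 0}) \<and>
     closure {x. \<phi> x \<noteq> 0} \<subseteq> M}"

definition locally_integrable :: "'a::euclidean_space set \<Rightarrow> ('a \<Rightarrow> real) \<Rightarrow> bool" where
  "locally_integrable M u \<longleftrightarrow> (\<forall>K. compact K \<and> K \<subseteq> M \<longrightarrow> integrable (lebesgue_on K) u)"

definition weak_partial ::
  "(real^'n) set \<Rightarrow> (real^'n \<Rightarrow> real) \<Rightarrow> 'n::finite \<Rightarrow> (real^'n \<Rightarrow> real) \<Rightarrow> bool" where
  "weak_partial M u i g \<longleftrightarrow> locally_integrable M u \<and> locally_integrable M g \<and>
     (\<forall>\<phi>\<in>test_functions M.
        (\<integral>x. u x * frechet_derivative \<phi> (at x) (axis i 1) \<partial>lebesgue_on M) =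
        - (\<integral>x. g x * \<phi> x \<partial>lebesgue_on M))"

definition L2 :: "'a::euclidean_space set \<Rightarrow> ('a \<Rightarrow> real) set" where
  "L2 M = {u. u \<in> borel_measurable (lebesgue_on M) \<and> integrable (lebesgue_on M) (\<lambda>x. (u x)\<^sup>2)}"

definition H1 :: "(real^'n::finite) set \<Rightarrow> (real^'n \<Rightarrow> real) set" where
  "H1 M = {u \<in> L2 M. \<forall>i. \<exists>g\<in>L2 M. weak_partial M u i g}"

definition H1_vec :: "(real^'n::finite) set \<Rightarrow> (real^'n \<Rightarrow> real^'c::finite) set" where
  "H1_vec M = {S. \<forall>j. (\<lambda>x. S x $ j) \<in> H1 M}"

definition weak_jacobian ::
  "(real^'n::finite) set \<Rightarrow> (real^'n \<Rightarrow> real^'c::finite) \<Rightarrow> (real^'n \<Rightarrow> real^'n^'c) \<Rightarrow> bool" where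
  "weak_jacobian M S G \<longleftrightarrow> (\<forall>j i. weak_partial M (\<lambda>x. S x $ j) i (\<lambda>x. G x $ j $ i))"

text \<open>A representative of the weak derivative, which on an open set is unique up to null sets.\<close>

definition weak_D ::
  "(real^'n::finite) set \<Rightarrow> (real^'n \<Rightarrow> real^'c::finite) \<Rightarrow> real^'n \<Rightarrow> real^'n^'c" where
  "weak_D M S = (SOME G. weak_jacobian M S G)"

definition prob_simplex :: "(real^'c::finite) set" where
  "prob_simplex = {p. (\<forall>j. p $ j \<ge> 0) \<and> (\<Sum>j\<in>UNIV. p $ j) = 1}"

definition D1 :: "(real^'n::finite) set \<Rightarrow> (real^'n \<Rightarrow> real^'c::finite) set" where
  "D1 M = {S \<in> H1_vec M. AE x in lebesgue_on M. S x \<in> prob_simplex}"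

text \<open>The library norm of a matrix in \<open>real^'n^'c\<close> is its Frobenius norm.\<close>

definition energy_density ::
  "(real^'n::finite) set \<Rightarrow> real \<Rightarrow> (real^'n \<Rightarrow> real^'c::finite) \<Rightarrow> real^'n \<Rightarrow> real" where
  "energy_density M \<alpha> S x = (norm (weak_D M S x))\<^sup>2 - \<alpha> * (norm (S x))\<^sup>2"

definition energy ::
  "(real^'n::finite) set \<Rightarrow> real \<Rightarrow> (real^'n \<Rightarrow> real^'c::finite) \<Rightarrow> real" where
  "energy M \<alpha> S = (\<integral>x. energy_density M \<alpha> S x \<partial>lebesgue_on M)"

text \<open>The almost-everywhere class of a field; only the values on \<open>M\<close> matter.\<close>

definition ae_class ::
  "(real^'n::finite) set \<Rightarrow> (real^'n \<Rightarrow> real^'c::finite) \<Rightarrow> (real^'n \<Rightarrow> real^'c) set" where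
  "ae_class M S = {T. AE x in lebesgue_on M. T x = S x}"

end

theory Submission
  imports Defs "HOL-Computational_Algebra.Polynomial"
begin

text \<open>
  On \<open>D1 M\<close> we have \<open>\<parallel>S x\<parallel>\<^sup>2 \<le> 1\<close> almost everywhere, so the energy plus \<open>\<alpha> Vol M\<close> is the integral of the
  nonnegative function \<open>\<parallel>DS\<parallel>\<^sup>2 + \<alpha> (1 - \<parallel>S\<parallel>\<^sup>2)\<close>. It vanishes iff \<open>DS = 0\<close>, which on a connected set means
  that \<open>S\<close> is a constant \<open>p\<close>, and, for \<open>\<alpha> > 0\<close>, additionally \<open>\<parallel>p\<parallel> = 1\<close>, which singles out the vertices
  of the simplex.

  Mollification is avoided: all test functions are tensor products of one-dimensional ones. Products of
  smooth bumps converge boundedly to indicators of open boxes, so a locally integrable function is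
  determined by its integrals against test functions. If \<open>u\<close> has zero weak gradient and
  \<open>\<integral> \<eta> = 1\<close>, then \<open>\<psi> - (\<integral> \<psi>) \<eta>\<close> is the derivative of a compactly supported smooth function, so in each
  coordinate the factor \<open>\<psi>\<close> can be replaced by \<open>(\<integral> \<psi>) \<eta>\<close>; hence \<open>\<integral> u\<close> over a box is a fixed multiple of its
  volume.
\<close>

subsection \<open>Smooth functions and test functions\<close>

lemma C_k_SucI:
  assumes "\<And>x. (f has_derivative D x) (at x)" "\<And>b. b \<in> Basis \<Longrightarrow> C_k k (\<lambda>x. D x b)"
  shows "C_k (Suc k) f"
proof -
  have "frechet_derivative f (at x) = D x" for x
    using assms(1) frechet_derivative_at by metis
  then show ?thesis
    using assms by (auto simp: differentiable_def)
qed

lemma C_k_Suc_has_derivative: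
  assumes "C_k (Suc k) f"
  shows "(f has_derivative frechet_derivative f (at x)) (at x)"
  using assms by (simp add: frechet_derivative_works)

lemma C_k_SucD: "C_k (Suc k) f \<Longrightarrow> C_k k f"
proof (induction k arbitrary: f)
  case 0
  then show ?case
    by (auto simp: continuous_on_eq_continuous_within differentiable_imp_continuous_within)
next
  case (Suc k)
  then show ?case by (metis C_k.simps(2))
qed

lemma C_k_const: "C_k k (\<lambda>x. c)"
proof (induction k arbitrary: c)
  case (Suc k)
  show ?case by (rule C_k_SucI[where D="\<lambda>x h. 0"]) (auto simp: Suc)
qed simp

lemma C_k_add: "C_k k f \<Longrightarrow> C_k k g \<Longrightarrow> C_k k (\<lambda>x. f x + g x)"
proof (induction k arbitrary: f g)
  case (Suc k)
  show ?case
  proof (rule C_k_SucI)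
    show "((\<lambda>x. f x + g x) has_derivative
        (\<lambda>h. frechet_derivative f (at x) h + frechet_derivative g (at x) h)) (at x)" for x
      using Suc.prems by (intro has_derivative_add C_k_Suc_has_derivative)
    show "C_k k (\<lambda>x. frechet_derivative f (at x) b + frechet_derivative g (at x) b)"
      if "b \<in> Basis" for b
      using Suc.prems that by (intro Suc.IH) auto
  qed
qed (auto intro: continuous_intros)

lemma C_k_mult: "C_k k f \<Longrightarrow> C_k k g \<Longrightarrow> C_k k (\<lambda>x. f x * g x)"
proof (induction k arbitrary: f g)
  case (Suc k)
  have "C_k k f" "C_k k g" using Suc.prems C_k_SucD by auto
  show ?case
  proof (rule C_k_SucI)
    show "((\<lambda>x. f x * g x) has_derivative
        (\<lambda>h. f x * frechet_derivative g (at x) h + frechet_derivative f (at x) h * g x)) (at x)" for x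
      using Suc.prems by (intro has_derivative_mult C_k_Suc_has_derivative)
    show "C_k k (\<lambda>x. f x * frechet_derivative g (at x) b + frechet_derivative f (at x) b * g x)"
      if "b \<in> Basis" for b
      using Suc.prems that \<open>C_k k f\<close> \<open>C_k k g\<close> by (intro C_k_add Suc.IH) auto
  qed
qed (auto intro: continuous_intros)

lemma C_k_cmult: "C_k k f \<Longrightarrow> C_k k (\<lambda>x. c * f x)"
  by (intro C_k_mult C_k_const)

lemma C_k_diff: "C_k k f \<Longrightarrow> C_k k g \<Longrightarrow> C_k k (\<lambda>x. f x - g x)"
  using C_k_add[of k f "\<lambda>x. (-1) * g x"] C_k_cmult[of k g "-1"] by simp

lemma C_k_prod: "finite I \<Longrightarrow> (\<And>i. i \<in> I \<Longrightarrow> C_k k (f i)) \<Longrightarrow> C_k k (\<lambda>x. \<Prod>i\<in>I. f i x)"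
  by (induction I rule: finite_induct) (auto intro: C_k_const C_k_mult)

lemma C_k_compose_affine:
  fixes f :: "real \<Rightarrow> real"
  assumes "bounded_linear l"
  shows "C_k k f \<Longrightarrow> C_k k (\<lambda>x. f (l x + c))"
proof (induction k arbitrary: f)
  case 0
  then show ?case
    using assms by (auto intro!: continuous_on_compose2[of UNIV f] continuous_intros
        simp: linear_continuous_on)
next
  case (Suc k)
  let ?D = "\<lambda>x. frechet_derivative f (at x)"
  have lin: "?D t h = h * ?D t 1" for t h
  proof -
    have "linear (?D t)"
      using C_k_Suc_has_derivative[OF Suc.prems] by (rule has_derivative_linear)
    from linear_scale[OF this, of h 1] show ?thesis by simp
  qed
  show ?case
  proof (rule C_k_SucI[where D="\<lambda>x h. ?D (l x + c) (l h)"])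
    fix x
    have "((\<lambda>x. l x + c) has_derivative l) (at x)"
      using has_derivative_add[OF bounded_linear_imp_has_derivative[OF assms] has_derivative_const] by simp
    from diff_chain_at[OF this C_k_Suc_has_derivative[OF Suc.prems]]
    show "((\<lambda>x. f (l x + c)) has_derivative (\<lambda>h. ?D (l x + c) (l h))) (at x)"
      by (simp add: o_def)
  next
    fix b :: 'a
    have "C_k k (\<lambda>x. ?D (l x + c) 1)"
      using Suc.prems by (intro Suc.IH) simp
    then show "C_k k (\<lambda>x. ?D (l x + c) (l b))"
      by (subst lin) (rule C_k_cmult)
  qed
qed

lemma C_k_Suc_real:
  fixes f :: "real \<Rightarrow> real"
  assumes "\<And>x. (f has_real_derivative f' x) (at x)" "C_k k f'"
  shows "C_k (Suc k) f"
  by (rule C_k_SucI[where D="\<lambda>x h. f' x * h"])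
    (use assms in \<open>auto simp: has_field_derivative_def\<close>)

text \<open>The functions \<open>p (1/t) exp (-1/t)\<close>, extended by zero, are closed under differentiation; this makes
  \<open>exp (-1/t)\<close> smooth at \<open>0\<close>.\<close>

definition flat :: "real poly \<Rightarrow> real \<Rightarrow> real" where
  "flat p t = (if t \<le> 0 then 0 else poly p (1 / t) * exp (- 1 / t))"

lemma poly_exp_tendsto_0: "((\<lambda>y. y ^ m * poly p y * exp (- y)) \<longlongrightarrow> (0::real)) at_top"
proof (induction p arbitrary: m)
  case (pCons a p)
  have "((\<lambda>y. a * (y ^ m / exp y) + y ^ Suc m * poly p y * exp (- y)) \<longlongrightarrow> a * 0 + 0) at_top"
    by (intro tendsto_intros tendsto_power_div_exp_0 pCons)
  then show ?case by (simp add: algebra_simps exp_minus divide_inverse)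
qed simp

lemma flat_has_derivative:
  "(flat p has_real_derivative flat ([:0, 0, 1:] * (p - pderiv p)) t) (at t)"
proof -
  let ?q = "[:0, 0, 1:] * (p - pderiv p)"
  consider "t < 0" | "t > 0" | "t = 0" by linarith
  then show ?thesis
  proof cases
    case 1
    have "((\<lambda>t. 0) has_real_derivative 0) (at t)" by simp
    then have "(flat p has_real_derivative 0) (at t)"
      by (rule has_field_derivative_transform_within_open[where S="{..<0}"])
        (use 1 in \<open>auto simp: flat_def\<close>)
    with 1 show ?thesis by (simp add: flat_def)
  next
    case 2
    have "((\<lambda>t. poly p (1 / t) * exp (- 1 / t)) has_real_derivative
        (poly (pderiv p) (1 / t) * (- 1 / t\<^sup>2)) * exp (- 1 / t)
        + exp (- 1 / t) * (1 / t\<^sup>2) * poly p (1 / t)) (at t)"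
      using 2 by (auto intro!: derivative_eq_intros simp: power2_eq_square divide_simps)
    also have "(poly (pderiv p) (1 / t) * (- 1 / t\<^sup>2)) * exp (- 1 / t)
        + exp (- 1 / t) * (1 / t\<^sup>2) * poly p (1 / t) = flat ?q t"
      using 2 by (simp add: flat_def field_simps power2_eq_square)
    finally show ?thesis
      by (rule has_field_derivative_transform_within_open[where S="{0<..}"])
        (use 2 in \<open>auto simp: flat_def\<close>)
  next
    case 3
    have "((\<lambda>h. inverse h ^ 1 * poly p (inverse h) * exp (- inverse h)) \<longlongrightarrow> 0) (at_right (0::real))"
      by (rule filterlim_compose[OF poly_exp_tendsto_0 filterlim_inverse_at_top_right])
    then have "((\<lambda>h. flat p h / h) \<longlongrightarrow> 0) (at_right 0)"
      by (rule Lim_transform_eventually)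
        (auto simp: eventually_at_right_less flat_def field_simps intro!: eventually_mono[OF eventually_at_right_less])
    moreover have "((\<lambda>h. flat p h / h) \<longlongrightarrow> 0) (at_left 0)"
      by (rule Lim_transform_eventually[OF tendsto_const])
        (auto simp: flat_def eventually_at_filter)
    ultimately have "((\<lambda>h. flat p h / h) \<longlongrightarrow> 0) (at 0)"
      by (simp add: filterlim_split_at)
    with 3 show ?thesis by (simp add: DERIV_def flat_def)
  qed
qed

lemma C_k_flat: "C_k k (flat p)"
proof (induction k arbitrary: p)
  case 0
  show ?case
    using flat_has_derivative[of p] by (auto intro!: DERIV_isCont continuous_at_imp_continuous_on)
next
  case (Suc k)
  show ?case by (rule C_k_Suc_real[OF flat_has_derivative Suc])
qed

definition bump :: "real \<Rightarrow> real \<Rightarrow> nat \<Rightarrow> real \<Rightarrow> real" where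
  "bump a b n t = flat 1 (real (Suc n) * (t - a)) * flat 1 (real (Suc n) * (b - t))"

lemma C_k_bump: "C_k k (bump a b n)"
proof -
  have "C_k k (\<lambda>t. flat 1 (real (Suc n) * t + - real (Suc n) * a) * flat 1 (- real (Suc n) * t + real (Suc n) * b))"
    by (intro C_k_mult C_k_compose_affine bounded_linear_mult_right C_k_flat)
  then show ?thesis
    by (simp add: bump_def[abs_def] algebra_simps)
qed

lemma flat_1_bounds: "0 \<le> flat 1 t" "flat 1 t \<le> 1"
  by (auto simp: flat_def)

lemma bump_bounds: "0 \<le> bump a b n t" "bump a b n t \<le> 1"
  by (auto simp: bump_def flat_1_bounds mult_le_one)

lemma bump_eq_0_iff: "bump a b n t = 0 \<longleftrightarrow> \<not> (a < t \<and> t < b)"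
  by (auto simp: bump_def flat_def mult_le_0_iff not_less zero_less_mult_iff simp del: of_nat_Suc)

lemma flat_1_tendsto:
  assumes "t > 0"
  shows "(\<lambda>n. flat 1 (real (Suc n) * t)) \<longlonglongrightarrow> 1"
proof -
  have "(\<lambda>n. exp (- (inverse t * inverse (real (Suc n))))) \<longlonglongrightarrow> exp (- (inverse t * 0))"
    by (intro tendsto_intros LIMSEQ_inverse_real_of_nat)
  moreover have "flat 1 (real (Suc n) * t) = exp (- (inverse t * inverse (real (Suc n))))" for n
  proof -
    have "real (Suc n) * t > 0" using assms by simp
    then show ?thesis by (simp add: flat_def divide_inverse mult.commute del: of_nat_Suc)
  qed
  ultimately show ?thesis by simp
qed

lemma bump_tendsto: "(\<lambda>n. bump a b n t) \<longlonglongrightarrow> indicator {a<..<b} t"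
proof (cases "a < t \<and> t < b")
  case True
  then have "(\<lambda>n. flat 1 (real (Suc n) * (t - a)) * flat 1 (real (Suc n) * (b - t))) \<longlonglongrightarrow> 1 * 1"
    by (intro tendsto_mult flat_1_tendsto) auto
  with True show ?thesis by (simp add: bump_def)
next
  case False
  then have "bump a b n t = 0" for n by (simp add: bump_eq_0_iff)
  with False show ?thesis by (auto simp: indicator_def)
qed

definition tensor :: "('n::finite \<Rightarrow> real \<Rightarrow> real) \<Rightarrow> real^'n \<Rightarrow> real" where
  "tensor \<phi> x = (\<Prod>i\<in>UNIV. \<phi> i (x $ i))"

definition smooth_on_ivl :: "real \<Rightarrow> real \<Rightarrow> (real \<Rightarrow> real) \<Rightarrow> bool" where
  "smooth_on_ivl a b f \<longleftrightarrow> (\<forall>k. C_k k f) \<and> (\<forall>t. t \<notin> {a..b} \<longrightarrow> f t = 0)"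

lemma tensor_test_function:
  assumes "\<And>i. smooth_on_ivl (a $ i) (b $ i) (\<phi> i)" "cbox a b \<subseteq> M"
  shows "tensor \<phi> \<in> test_functions M"
proof -
  have "C_k k (tensor \<phi>)" for k
  proof -
    have "C_k k (\<lambda>x. \<Prod>i\<in>UNIV. \<phi> i (x $ i + 0))"
      using assms(1) by (intro C_k_prod C_k_compose_affine bounded_linear_vec_nth)
        (auto simp: smooth_on_ivl_def)
    then show ?thesis by (simp add: tensor_def[abs_def])
  qed
  moreover have "tensor \<phi> x = 0" if "x \<notin> cbox a b" for x
    using that assms(1) by (auto simp: tensor_def mem_box_cart smooth_on_ivl_def)
  then have "closure {x. tensor \<phi> x \<noteq> 0} \<subseteq> cbox a b"
    by (intro closure_minimal) auto
  moreover from this have "compact (closure {x. tensor \<phi> x \<noteq> 0})"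
    by (metis bounded_cbox bounded_subset closed_closure compact_eq_bounded_closed)
  ultimately show ?thesis
    using assms(2) by (auto simp: test_functions_def)
qed

lemma frechet_derivative_tensor:
  assumes "\<And>j k. C_k k (\<phi> j)" and \<Psi>: "\<And>t. (\<phi> i has_real_derivative w t) (at t)"
  shows "frechet_derivative (tensor \<phi>) (at x) (axis i 1) = tensor (\<phi>(i := w)) x"
proof -
  define D where "D j t = frechet_derivative (\<phi> j) (at t)" for j t
  have D: "(\<phi> j has_derivative D j t) (at t)" for j t
    unfolding D_def using assms(1) C_k_Suc_has_derivative by blast
  have "((\<lambda>x. \<phi> j (x $ j)) has_derivative (\<lambda>h. D j (x $ j) (h $ j))) (at x)" for j
    using diff_chain_at[OF bounded_linear_imp_has_derivative[OF bounded_linear_vec_nth] D[of j "x $ j"]]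
    by (simp add: o_def)
  then have "(tensor \<phi> has_derivative
      (\<lambda>h. \<Sum>j\<in>UNIV. D j (x $ j) (h $ j) * (\<Prod>l\<in>UNIV - {j}. \<phi> l (x $ l)))) (at x)"
    unfolding tensor_def[abs_def] by (intro has_derivative_prod) auto
  then have "frechet_derivative (tensor \<phi>) (at x) (axis i 1) =
      (\<Sum>j\<in>UNIV. D j (x $ j) (axis i 1 $ j) * (\<Prod>l\<in>UNIV - {j}. \<phi> l (x $ l)))"
    by (simp add: frechet_derivative_at[symmetric])
  also have "\<dots> = (\<Sum>j\<in>UNIV. if j = i then w (x $ i) * (\<Prod>l\<in>UNIV - {i}. \<phi> l (x $ l)) else 0)"
  proof (rule sum.cong[OF refl])
    fix j
    have "D i t = (\<lambda>h. w t * h)" for t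
      using \<Psi> D has_derivative_unique by (metis has_field_derivative_def)
    moreover have "D j t 0 = 0" for t
      using D has_derivative_linear linear_0 by blast
    ultimately show "D j (x $ j) (axis i 1 $ j) * (\<Prod>l\<in>UNIV - {j}. \<phi> l (x $ l)) =
      (if j = i then w (x $ i) * (\<Prod>l\<in>UNIV - {i}. \<phi> l (x $ l)) else 0)"
      by (auto simp: axis_def)
  qed
  also have "\<dots> = tensor (\<phi>(i := w)) x"
    by (simp add: tensor_def prod.remove[of UNIV i])
  finally show ?thesis .
qed

subsection \<open>Uniqueness of weak derivatives\<close>

lemma AE_zero_if_box_integrals_zero:
  fixes f :: "'a::euclidean_space \<Rightarrow> real"
  assumes f: "integrable lebesgue f"
    and box: "\<And>a b. (LINT x:box a b|lebesgue. f x) = 0"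
  shows "AE x in lebesgue. f x = 0"
proof -
  obtain g where g[measurable]: "g \<in> borel_measurable lborel" and "AE x in lborel. f x = g x"
    using completion_ex_borel_measurable_real[of f lborel] f by auto
  then have fg: "AE x in lebesgue. f x = g x"
    using AE_completion by blast
  have "integrable lebesgue g"
    using f _ fg by (rule integrable_cong_AE_imp) (use g in \<open>rule measurable_completion\<close>)
  then have ig: "integrable lborel g"
    using integrable_completion[OF g] by simp
  then have sig: "set_integrable lborel A g" if "A \<in> sets borel" for A
    unfolding set_integrable_def using that by (intro integrable_mult_indicator ig) simp
  have boxg: "(LINT x:box a b|lborel. g x) = 0" for a b
  proof -
    have "(LINT x:box a b|lborel. g x) = (LINT x:box a b|lebesgue. g x)"
      unfolding set_lebesgue_integral_def by (subst integral_completion) auto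
    also have "\<dots> = (LINT x:box a b|lebesgue. f x)"
      unfolding set_lebesgue_integral_def
    proof (rule integral_cong_AE)
      show "AE x in lebesgue. indicat_real (box a b) x *\<^sub>R g x = indicat_real (box a b) x *\<^sub>R f x"
        using fg by eventually_elim auto
      show "(\<lambda>x. indicat_real (box a b) x *\<^sub>R g x) \<in> borel_measurable lebesgue"
        by (rule measurable_completion) simp
      show "(\<lambda>x. indicat_real (box a b) x *\<^sub>R f x) \<in> borel_measurable lebesgue"
        using f by (intro borel_measurable_integrable integrable_mult_indicator) auto
    qed
    finally show ?thesis using box by simp
  qed
  define B :: "nat \<Rightarrow> 'a set" where "B i = box (- (real i *\<^sub>R One)) (real i *\<^sub>R One)" for i
  have "(\<lambda>i. LINT x:B i|lborel. g x) \<longlonglongrightarrow> (LINT x:(\<Union>i. B i)|lborel. g x)"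
  proof (rule set_integral_cont_up)
    show "incseq B"
      unfolding B_def
      by (intro monoI subset_box_imp) auto
  qed (auto simp: B_def sig UN_box_eq_UNIV)
  then have UNIV: "(LINT x:UNIV|lborel. g x) = 0"
    unfolding B_def boxg UN_box_eq_UNIV by (simp add: LIMSEQ_const_iff)
  have "(LINT x:A|lborel. g x) = 0" if "A \<in> sets lborel" for A
  proof -
    let ?G = "range (\<lambda>(a, b). box a b :: 'a set)"
    have "Int_stable ?G"
      by (auto simp: Int_stable_def box_Int_box)
    moreover have "?G \<subseteq> Pow UNIV" "A \<in> sigma_sets UNIV ?G"
      using that by (auto simp: borel_eq_box)
    ultimately show ?thesis
    proof (induction rule: sigma_sets_induct_disjoint)
      case (compl A)
      then have A: "A \<in> sets borel" by (simp add: borel_eq_box)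
      have "(LINT x:A \<union> (UNIV - A)|lborel. g x) = (LINT x:A|lborel. g x) + (LINT x:UNIV - A|lborel. g x)"
        using A by (intro set_integral_Un sig) auto
      with compl UNIV show ?case by simp
    next
      case (union A)
      then have A: "A i \<in> sets borel" for i by (auto simp add: borel_eq_box)
      have "(LINT x:(\<Union>i. A i)|lborel. g x) = (\<Sum>i. (LINT x:(A i)|lborel. g x))"
        using A union by (intro lebesgue_integral_countable_add sig) (auto simp: disjoint_family_on_def)
      with union show ?case by simp
    next
      case empty
      show ?case by (simp add: set_lebesgue_integral_def)
    qed (auto simp: boxg)
  qed
  then have "AE x in lborel. g x = 0"
    using ig by (intro density_unique_real) auto
  then have "AE x in lebesgue. g x = 0"
    by (rule AE_completion)
  with fg show ?thesis by eventually_elim simp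
qed

lemma AE_eq_on_cbox_if_box_integrals_eq:
  fixes f g :: "'a::euclidean_space \<Rightarrow> real"
  assumes f: "set_integrable lebesgue (cbox A B) f" and g: "set_integrable lebesgue (cbox A B) g"
    and box: "\<And>a b. cbox a b \<subseteq> cbox A B \<Longrightarrow> box a b \<noteq> {} \<Longrightarrow>
      (LINT x:box a b|lebesgue. f x) = (LINT x:box a b|lebesgue. g x)"
  shows "AE x in lebesgue. x \<in> cbox A B \<longrightarrow> f x = g x"
proof -
  let ?h = "\<lambda>x. indicat_real (cbox A B) x *\<^sub>R (f x - g x)"
  have h: "set_integrable lebesgue (cbox A B) (\<lambda>x. f x - g x)"
    by (rule set_integral_diff(1)[OF f g])
  have "(LINT x:box a b|lebesgue. ?h x) = 0" for a b
  proof -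
    obtain a' b' where ab: "box a b \<inter> box A B = box a' b'"
      by (auto simp: box_Int_box)
    have "AE x in lebesgue. x \<notin> cbox A B - box A B"
      using negligible_frontier_interval[of A B] by (intro AE_not_in) (simp add: negligible_iff_null_sets)
    then have "AE x in lebesgue. indicat_real (box a b) x *\<^sub>R ?h x = indicat_real (box a' b') x *\<^sub>R (f x - g x)"
    proof eventually_elim
      case (elim x)
      then have "x \<in> box a' b' \<longleftrightarrow> x \<in> box a b \<and> x \<in> cbox A B"
        using ab box_subset_cbox[of A B] by blast
      then show ?case by (auto simp: indicator_def)
    qed
    then have "(LINT x:box a b|lebesgue. ?h x) = (LINT x:box a' b'|lebesgue. f x - g x)"
      unfolding set_lebesgue_integral_def
    proof (intro integral_cong_AE)
      have "integrable lebesgue (\<lambda>x. indicat_real (box a b) x *\<^sub>R ?h x)"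
        using h unfolding set_integrable_def by (rule integrable_mult_indicator[rotated]) simp
      then show "(\<lambda>x. indicat_real (box a b) x *\<^sub>R ?h x) \<in> borel_measurable lebesgue" by simp
      have "set_integrable lebesgue (box a' b') (\<lambda>x. f x - g x)"
        using ab box_subset_cbox[of A B] by (intro set_integrable_subset[OF h]) auto
      then show "(\<lambda>x. indicat_real (box a' b') x *\<^sub>R (f x - g x)) \<in> borel_measurable lebesgue"
        by (simp add: set_integrable_def)
    qed
    also have "\<dots> = 0"
    proof (cases "box a' b' = {}")
      case False
      then have sub: "cbox a' b' \<subseteq> cbox A B"
        using ab box_subset_cbox[of A B] by (metis closure_box closed_cbox closure_minimal inf.cobounded2 order_trans)
      have "set_integrable lebesgue (box a' b') f" "set_integrable lebesgue (box a' b') g"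
        using sub box_subset_cbox[of a' b']
        by (intro set_integrable_subset[OF f] set_integrable_subset[OF g]; simp)+
      with box[OF sub False] show ?thesis by (simp add: set_integral_diff)
    qed (simp add: set_lebesgue_integral_def)
    finally show ?thesis .
  qed
  then have "AE x in lebesgue. ?h x = 0"
    using h unfolding set_integrable_def by (intro AE_zero_if_box_integrals_zero)
  then show ?thesis
    by eventually_elim (auto simp: indicator_def)
qed

lemma locally_integrable_set_integrable:
  "locally_integrable M u \<Longrightarrow> compact K \<Longrightarrow> K \<subseteq> M \<Longrightarrow> set_integrable lebesgue K u"
  by (auto simp: locally_integrable_def set_integrable_def integrable_restrict_space lmeasurable_compact fmeasurableD)

lemma integral_lebesgue_on:
  fixes f :: "'a::euclidean_space \<Rightarrow> real"
  assumes "M \<in> sets lebesgue"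
  shows "(\<integral>x. f x \<partial>lebesgue_on M) = (LINT x:M|lebesgue. f x)"
  using assms by (simp add: integral_restrict_space set_lebesgue_integral_def)

lemma integrable_mult_compact_support:
  fixes u \<phi> :: "'a::euclidean_space \<Rightarrow> real"
  assumes u: "locally_integrable M u" and M: "M \<in> sets lebesgue" and \<phi>: "continuous_on UNIV \<phi>"
    and K: "compact K" "K \<subseteq> M" "\<And>x. x \<notin> K \<Longrightarrow> \<phi> x = 0"
  shows "integrable (lebesgue_on M) (\<lambda>x. u x * \<phi> x)"
proof -
  have iu: "integrable lebesgue (\<lambda>x. indicat_real K x *\<^sub>R u x)"
    using locally_integrable_set_integrable[OF u K(1,2)] by (simp add: set_integrable_def)
  have "bounded (\<phi> ` K)"
    using \<phi> K(1) by (meson compact_continuous_image compact_imp_bounded continuous_on_subset subset_UNIV)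
  then obtain C where C: "\<And>x. x \<in> K \<Longrightarrow> \<bar>\<phi> x\<bar> \<le> C"
    by (auto simp: bounded_iff)
  have [measurable]: "\<phi> \<in> borel_measurable lebesgue"
    using \<phi> by (intro measurable_completion) (auto intro: borel_measurable_continuous_onI)
  have "integrable lebesgue (\<lambda>x. (indicat_real K x *\<^sub>R u x) * \<phi> x)"
  proof (rule Bochner_Integration.integrable_bound)
    show "integrable lebesgue (\<lambda>x. C * (indicat_real K x *\<^sub>R u x))"
      using iu by (rule integrable_mult_right)
    show "AE x in lebesgue. norm ((indicat_real K x *\<^sub>R u x) * \<phi> x) \<le> norm (C * (indicat_real K x *\<^sub>R u x))"
    proof (rule AE_I2)
      fix x
      show "norm ((indicat_real K x *\<^sub>R u x) * \<phi> x) \<le> norm (C * (indicat_real K x *\<^sub>R u x))"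
        using C[of x] by (cases "x \<in> K") (auto simp: abs_mult mult.commute intro!: mult_right_mono)
    qed
  qed (use iu in \<open>auto intro: borel_measurable_times\<close>)
  also have "(\<lambda>x. (indicat_real K x *\<^sub>R u x) * \<phi> x) = (\<lambda>x. indicat_real M x *\<^sub>R (u x * \<phi> x))"
    using K(2,3) by (force simp: indicator_def)
  finally show ?thesis
    using M by (simp add: integrable_restrict_space)
qed

lemma test_functionD:
  assumes "\<phi> \<in> test_functions M"
  shows "C_k k \<phi>" and "continuous_on UNIV \<phi>"
    and "compact (closure {x. \<phi> x \<noteq> 0})" and "closure {x. \<phi> x \<noteq> 0} \<subseteq> M"
    and "x \<notin> closure {x. \<phi> x \<noteq> 0} \<Longrightarrow> \<phi> x = 0"
  using assms closure_subset[of "{x. \<phi> x \<noteq> 0}"] C_k.simps(1)[of \<phi>]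
  unfolding test_functions_def by blast+

lemma integrable_mult_test_function:
  assumes "locally_integrable M u" "M \<in> sets lebesgue" "\<phi> \<in> test_functions M"
  shows "integrable (lebesgue_on M) (\<lambda>x. u x * \<phi> x)"
  using integrable_mult_compact_support[OF assms(1,2) test_functionD(2-5)[OF assms(3)]] .

definition bumps :: "real^'n \<Rightarrow> real^'n \<Rightarrow> nat \<Rightarrow> 'n::finite \<Rightarrow> real \<Rightarrow> real" where
  "bumps a b n i = bump (a $ i) (b $ i) n"

lemma smooth_on_ivl_bump: "A \<le> a \<Longrightarrow> b \<le> B \<Longrightarrow> smooth_on_ivl A B (bump a b n)"
  by (auto simp: smooth_on_ivl_def C_k_bump bump_eq_0_iff)

lemma integral_tensor_bumps_tendsto:
  fixes u :: "real^'n::finite \<Rightarrow> real"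
  assumes u: "locally_integrable M u" and M: "M \<in> sets lebesgue" and ab: "cbox a b \<subseteq> M"
  shows "(\<lambda>n. \<integral>x. u x * tensor (bumps a b n) x \<partial>lebesgue_on M)
    \<longlonglongrightarrow> (LINT x:box a b|lebesgue. u x)"
  unfolding integral_lebesgue_on[OF M] set_lebesgue_integral_def
proof (rule integral_dominated_convergence)
  have "set_integrable lebesgue (cbox a b) u"
    using locally_integrable_set_integrable[OF u compact_cbox ab] .
  then show "integrable lebesgue (\<lambda>x. norm (indicat_real (cbox a b) x *\<^sub>R u x))"
    unfolding set_integrable_def by (rule integrable_norm)
  have "set_integrable lebesgue (box a b) u"
    using \<open>set_integrable lebesgue (cbox a b) u\<close>
    by (rule set_integrable_subset) (auto simp: box_subset_cbox)
  then show "(\<lambda>x. indicat_real (box a b) x *\<^sub>R u x) \<in> borel_measurable lebesgue"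
    by (simp add: set_integrable_def)
  have bnd: "tensor (bumps a b n) x \<in> {0..1}" for n x
    unfolding tensor_def bumps_def by (auto intro!: prod_nonneg prod_le_1 bump_bounds)
  have out: "tensor (bumps a b n) x = 0" if "x \<notin> box a b" for n x
    using that by (auto simp: tensor_def bumps_def bump_eq_0_iff mem_box_cart)
  have lim: "(\<lambda>n. tensor (bumps a b n) x) \<longlonglongrightarrow> indicator (box a b) x" for x
  proof -
    have "(\<lambda>n. \<Prod>i\<in>UNIV. bump (a $ i) (b $ i) n (x $ i)) \<longlonglongrightarrow> (\<Prod>i\<in>UNIV. indicator {a $ i<..<b $ i} (x $ i))"
      by (intro tendsto_prod bump_tendsto)
    moreover have "(\<Prod>i\<in>UNIV. indicator {a $ i<..<b $ i} (x $ i)) = indicat_real (box a b) x"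
      by (auto simp: indicator_def mem_box_cart)
    ultimately show ?thesis by (simp add: tensor_def bumps_def)
  qed
  fix n
  have "tensor (bumps a b n) \<in> test_functions M"
    using ab by (intro tensor_test_function) (auto simp: bumps_def smooth_on_ivl_bump)
  from integrable_mult_test_function[OF u M this]
  show "(\<lambda>x. indicat_real M x *\<^sub>R (u x * tensor (bumps a b n) x)) \<in> borel_measurable lebesgue"
    using M by (simp add: integrable_restrict_space borel_measurable_integrable)
  show "AE x in lebesgue. norm (indicat_real M x *\<^sub>R (u x * tensor (bumps a b n) x))
      \<le> norm (indicat_real (cbox a b) x *\<^sub>R u x)"
  proof (rule AE_I2)
    fix x
    show "norm (indicat_real M x *\<^sub>R (u x * tensor (bumps a b n) x)) \<le> norm (indicat_real (cbox a b) x *\<^sub>R u x)"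
      using bnd[of n x] out[of x n] box_subset_cbox[of a b]
      by (cases "x \<in> box a b") (auto simp: abs_mult indicator_def intro!: mult_left_le)
  qed
  show "AE x in lebesgue. (\<lambda>n. indicat_real M x *\<^sub>R (u x * tensor (bumps a b n) x))
      \<longlonglongrightarrow> indicat_real (box a b) x *\<^sub>R u x"
  proof (rule AE_I2)
    fix x
    have "(\<lambda>n. indicat_real M x *\<^sub>R (u x * tensor (bumps a b n) x))
      \<longlonglongrightarrow> indicat_real M x *\<^sub>R (u x * indicat_real (box a b) x)"
      by (intro tendsto_intros lim)
    moreover have "indicat_real M x *\<^sub>R (u x * indicat_real (box a b) x) = indicat_real (box a b) x *\<^sub>R u x"
      using ab box_subset_cbox[of a b] by (auto simp: indicator_def)
    ultimately show "(\<lambda>n. indicat_real M x *\<^sub>R (u x * tensor (bumps a b n) x))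
      \<longlonglongrightarrow> indicat_real (box a b) x *\<^sub>R u x" by (simp only:)
  qed
qed

lemma AE_lebesgue_on_open_if_cbox:
  assumes "open M" "\<And>a b. cbox a b \<subseteq> M \<Longrightarrow> AE x in lebesgue. x \<in> cbox a b \<longrightarrow> P x"
  shows "AE x in lebesgue_on M. P x"
proof -
  obtain \<D> where "countable \<D>" and D: "\<D> \<subseteq> Pow M" "\<And>X. X \<in> \<D> \<Longrightarrow> \<exists>a b. X = cbox a b" "\<Union>\<D> = M"
    using open_countable_Union_open_cbox[OF assms(1)] by metis
  have "\<forall>X\<in>\<D>. AE x in lebesgue. x \<in> X \<longrightarrow> P x"
    using D(1,2) assms(2) by (metis PowD subsetD)
  then have "AE x in lebesgue. \<forall>X\<in>\<D>. x \<in> X \<longrightarrow> P x"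
    by (subst AE_ball_countable[OF \<open>countable \<D>\<close>])
  then have "AE x in lebesgue. x \<in> M \<longrightarrow> P x"
    by eventually_elim (use D(3) in auto)
  then show ?thesis
    using assms(1) by (simp add: AE_restrict_space_iff)
qed

lemma AE_eq_if_test_integrals_eq:
  fixes f g :: "real^'n::finite \<Rightarrow> real"
  assumes M: "open M" and f: "locally_integrable M f" and g: "locally_integrable M g"
    and eq: "\<And>\<phi>. \<phi> \<in> test_functions M \<Longrightarrow>
      (\<integral>x. f x * \<phi> x \<partial>lebesgue_on M) = (\<integral>x. g x * \<phi> x \<partial>lebesgue_on M)"
  shows "AE x in lebesgue_on M. f x = g x"
proof (rule AE_lebesgue_on_open_if_cbox[OF M])
  fix A B assume AB: "cbox A B \<subseteq> M"
  show "AE x in lebesgue. x \<in> cbox A B \<longrightarrow> f x = g x"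
  proof (rule AE_eq_on_cbox_if_box_integrals_eq)
    fix a b :: "real^'n" assume "cbox a b \<subseteq> cbox A B"
    with AB have ab: "cbox a b \<subseteq> M" by auto
    have "tensor (bumps a b n) \<in> test_functions M" for n
      using ab by (intro tensor_test_function) (auto simp: bumps_def smooth_on_ivl_bump)
    moreover have "M \<in> sets lebesgue" using M by simp
    ultimately show "(LINT x:box a b|lebesgue. f x) = (LINT x:box a b|lebesgue. g x)"
      using integral_tensor_bumps_tendsto[OF f _ ab] integral_tensor_bumps_tendsto[OF g _ ab]
      by (simp add: eq LIMSEQ_unique)
  qed (use AB f g in \<open>auto intro: locally_integrable_set_integrable\<close>)
qed

lemma weak_partial_unique:
  assumes "open M" "weak_partial M u i g" "weak_partial M u i h"
  shows "AE x in lebesgue_on M. g x = h x"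
  using assms by (intro AE_eq_if_test_integrals_eq) (auto simp: weak_partial_def)

subsection \<open>Functions with vanishing weak gradient\<close>

lemma smooth_on_ivl_continuous: "smooth_on_ivl a b f \<Longrightarrow> continuous_on S f"
  using C_k.simps(1)[of f] continuous_on_subset[of UNIV f S] unfolding smooth_on_ivl_def by blast

lemma smooth_on_ivl_integrable: "smooth_on_ivl a b f \<Longrightarrow> f integrable_on {c..d}"
  for f :: "real \<Rightarrow> real"
  by (intro integrable_continuous_interval smooth_on_ivl_continuous)

lemma smooth_on_ivl_antiderivative:
  assumes w: "smooth_on_ivl a b w" and "a \<le> b" and 0: "integral {a..b} w = 0"
  obtains \<Psi> where "smooth_on_ivl a b \<Psi>" "\<And>t. (\<Psi> has_real_derivative w t) (at t)"
proof -
  have "isCont w t" for t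
    using smooth_on_ivl_continuous[OF w, of UNIV] by (simp add: continuous_on_eq_continuous_at)
  then have "\<exists>F. \<forall>t. -\<infinity> < ereal t \<longrightarrow> ereal t < \<infinity> \<longrightarrow> (F has_vector_derivative w t) (at t)"
    by (intro einterval_antiderivative) simp_all
  then obtain F where "\<forall>t. -\<infinity> < ereal t \<longrightarrow> ereal t < \<infinity> \<longrightarrow> (F has_vector_derivative w t) (at t)" ..
  then have F: "(F has_real_derivative w t) (at t)" for t
    by (simp add: has_real_derivative_iff_has_vector_derivative)
  define \<Psi> where "\<Psi> = (\<lambda>t. F t - F a)"
  have \<Psi>: "(\<Psi> has_real_derivative w t) (at t)" for t
    unfolding \<Psi>_def by (auto intro!: derivative_eq_intros F)
  have "C_k k \<Psi>" for k
    using w \<Psi> by (intro C_k_SucD[OF C_k_Suc_real[of \<Psi> w]]) (auto simp: smooth_on_ivl_def)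
  moreover have "\<Psi> t = 0" if "t \<notin> {a..b}" for t
  proof -
    have w0: "w z = 0" if "z < a \<or> b < z" for z
      using w that by (auto simp: smooth_on_ivl_def)
    have "(w has_integral F b - F a) {a..b}"
      using \<open>a \<le> b\<close> F
      by (intro fundamental_theorem_of_calculus)
        (auto simp: has_real_derivative_iff_has_vector_derivative intro: has_vector_derivative_at_within)
    then have "F b = F a" using 0 by (simp add: integral_unique)
    moreover have "F t = F a" if "t < a"
      using MVT2[OF that F] w0 by auto
    moreover have "F t = F b" if "b < t"
      using MVT2[OF that F] w0 by auto
    ultimately show ?thesis using that by (auto simp: \<Psi>_def)
  qed
  ultimately show thesis
    using that \<Psi> by (auto simp: smooth_on_ivl_def)
qed

lemma tensor_fun_upd: "tensor (\<phi>(i := f)) x = f (x $ i) * (\<Prod>j\<in>UNIV - {i}. \<phi> j (x $ j))"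
proof -
  have "tensor (\<phi>(i := f)) x = (\<phi>(i := f)) i (x $ i) * (\<Prod>j\<in>UNIV - {i}. (\<phi>(i := f)) j (x $ j))"
    unfolding tensor_def by (rule prod.remove) auto
  also have "(\<Prod>j\<in>UNIV - {i}. (\<phi>(i := f)) j (x $ j)) = (\<Prod>j\<in>UNIV - {i}. \<phi> j (x $ j))"
    by (rule prod.cong) auto
  finally show ?thesis by (simp only: fun_upd_same)
qed

lemma integral_tensor_fun_upd:
  fixes u :: "real^'n::finite \<Rightarrow> real"
  assumes M: "M \<in> sets lebesgue" and u: "weak_partial M u i (\<lambda>_. 0)" and AB: "cbox A B \<subseteq> M" "A $ i \<le> B $ i"
    and \<phi>: "\<And>j. smooth_on_ivl (A $ j) (B $ j) (\<phi> j)"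
    and \<eta>: "smooth_on_ivl (A $ i) (B $ i) \<eta>" "integral {A $ i..B $ i} \<eta> = 1"
  shows "(\<integral>x. u x * tensor \<phi> x \<partial>lebesgue_on M) =
    integral {A $ i..B $ i} (\<phi> i) * (\<integral>x. u x * tensor (\<phi>(i := \<eta>)) x \<partial>lebesgue_on M)"
proof -
  define c where "c = integral {A $ i..B $ i} (\<phi> i)"
  define w where "w t = \<phi> i t - c * \<eta> t" for t
  have c\<eta>: "smooth_on_ivl (A $ i) (B $ i) (\<lambda>t. c * \<eta> t)"
    using \<eta>(1) unfolding smooth_on_ivl_def by (auto intro: C_k_cmult)
  have w: "smooth_on_ivl (A $ i) (B $ i) w"
    using \<phi>[of i] \<eta>(1) unfolding smooth_on_ivl_def w_def by (auto intro!: C_k_diff C_k_cmult)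
  have "integral {A $ i..B $ i} w = 0"
    unfolding w_def using \<eta>(2)
    by (subst integral_diff[OF smooth_on_ivl_integrable[OF \<phi>] smooth_on_ivl_integrable[OF c\<eta>]])
      (simp add: c_def)
  then obtain \<Psi> where \<Psi>: "smooth_on_ivl (A $ i) (B $ i) \<Psi>" "\<And>t. (\<Psi> has_real_derivative w t) (at t)"
    using smooth_on_ivl_antiderivative[OF w AB(2)] by metis
  have upd: "tensor (\<phi>(i := f)) \<in> test_functions M" if "smooth_on_ivl (A $ i) (B $ i) f" for f
    using \<phi> that by (intro tensor_test_function[OF _ AB(1)]) auto
  have "frechet_derivative (tensor (\<phi>(i := \<Psi>))) (at x) (axis i 1) = tensor (\<phi>(i := w)) x" for x
    using frechet_derivative_tensor[of "\<phi>(i := \<Psi>)" i w x] \<phi> \<Psi> by (auto simp: smooth_on_ivl_def)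
  then have "(\<integral>x. u x * tensor (\<phi>(i := w)) x \<partial>lebesgue_on M) = 0"
    using u upd[OF \<Psi>(1)] by (auto simp: weak_partial_def)
  moreover have "u x * tensor (\<phi>(i := w)) x = u x * tensor \<phi> x - c * (u x * tensor (\<phi>(i := \<eta>)) x)" for x
    using tensor_fun_upd[of \<phi> i "\<phi> i" x] by (simp add: tensor_fun_upd w_def algebra_simps)
  moreover have "integrable (lebesgue_on M) (\<lambda>x. u x * tensor \<phi> x)"
    using integrable_mult_test_function[OF _ M upd[OF \<phi>]] u by (simp add: weak_partial_def)
  moreover have "integrable (lebesgue_on M) (\<lambda>x. u x * tensor (\<phi>(i := \<eta>)) x)"
    using integrable_mult_test_function[OF _ M upd[OF \<eta>(1)]] u by (simp add: weak_partial_def)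
  ultimately show ?thesis
    by (simp add: c_def)
qed

lemma integral_tensor_eq_prod:
  fixes u :: "real^'n::finite \<Rightarrow> real"
  assumes M: "M \<in> sets lebesgue" and u: "\<And>i. weak_partial M u i (\<lambda>_. 0)"
    and AB: "cbox A B \<subseteq> M" "\<And>i. A $ i \<le> B $ i"
    and \<phi>: "\<And>j. smooth_on_ivl (A $ j) (B $ j) (\<phi> j)"
    and \<eta>: "\<And>j. smooth_on_ivl (A $ j) (B $ j) (\<eta> j)" "\<And>j. integral {A $ j..B $ j} (\<eta> j) = 1"
  shows "(\<integral>x. u x * tensor \<phi> x \<partial>lebesgue_on M) =
    (\<Prod>i\<in>UNIV. integral {A $ i..B $ i} (\<phi> i)) * (\<integral>x. u x * tensor \<eta> x \<partial>lebesgue_on M)"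
proof -
  let ?\<phi> = "\<lambda>I j. if j \<in> I then \<eta> j else \<phi> j"
  have "(\<integral>x. u x * tensor \<phi> x \<partial>lebesgue_on M) =
    (\<Prod>i\<in>I. integral {A $ i..B $ i} (\<phi> i)) * (\<integral>x. u x * tensor (?\<phi> I) x \<partial>lebesgue_on M)"
    if "finite I" for I
    using that
  proof induction
    case (insert i I)
    have "(\<integral>x. u x * tensor (?\<phi> I) x \<partial>lebesgue_on M) =
      integral {A $ i..B $ i} (?\<phi> I i) * (\<integral>x. u x * tensor ((?\<phi> I)(i := \<eta> i)) x \<partial>lebesgue_on M)"
      using \<phi> \<eta> by (intro integral_tensor_fun_upd[OF M u AB]) auto
    moreover have "(?\<phi> I)(i := \<eta> i) = ?\<phi> (insert i I)" by auto
    ultimately show ?case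
      using insert by simp
  qed simp
  from this[of UNIV] show ?thesis by simp
qed

lemma integral_bump_tendsto:
  assumes "A \<le> a" "a \<le> b" "b \<le> B"
  shows "(\<lambda>n. integral {A..B} (bump a b n)) \<longlonglongrightarrow> b - a"
proof -
  have "(\<lambda>n. integral {A..B} (bump a b n)) \<longlonglongrightarrow> integral {A..B} (indicat_real {a<..<b})"
  proof (rule dominated_convergence(2)[where h="\<lambda>_. 1"])
    show "bump a b n integrable_on {A..B}" for n
      by (rule smooth_on_ivl_integrable[OF smooth_on_ivl_bump[OF order_refl order_refl]])
  qed (auto simp: bump_bounds bump_tendsto)
  also have "((\<lambda>_. 1::real) has_integral b - a) {a..b}"
    using has_integral_const_real[of "1::real" a b] assms by simp
  then have "((\<lambda>_. 1::real) has_integral b - a) {a<..<b}"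
    by (simp add: has_integral_Icc_iff_Ioo)
  then have "((\<lambda>x. if x \<in> {a<..<b} then 1::real else 0) has_integral b - a) {A..B}"
    using assms by (subst has_integral_restrict) auto
  then have "(indicat_real {a<..<b} has_integral b - a) {A..B}"
    by (rule has_integral_eq[rotated]) (auto simp: indicator_def)
  then have "integral {A..B} (indicat_real {a<..<b}) = b - a"
    by (rule integral_unique)
  finally show ?thesis .
qed

lemma smooth_on_ivl_unit_integral:
  assumes "a < b"
  obtains \<eta> where "smooth_on_ivl a b \<eta>" "integral {a..b} \<eta> = 1"
proof -
  let ?c = "integral {a..b} (bump a b 0)"
  have s: "smooth_on_ivl a b (bump a b 0)" by (simp add: smooth_on_ivl_bump)
  have "\<not> (\<forall>t\<in>{a..b}. bump a b 0 t = 0)"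
    using dense[OF assms] by (auto simp: bump_eq_0_iff)
  then have "?c \<noteq> 0"
    using assms by (subst integral_eq_0_iff) (auto simp: bump_bounds smooth_on_ivl_continuous[OF s])
  then have "integral {a..b} (\<lambda>t. inverse ?c * bump a b 0 t) = 1"
    by simp
  moreover have "smooth_on_ivl a b (\<lambda>t. inverse ?c * bump a b 0 t)"
    using s by (auto simp: smooth_on_ivl_def intro: C_k_cmult)
  ultimately show thesis using that by blast
qed

lemma weak_gradient_zero_imp_constant_on_cbox:
  fixes u :: "real^'n::finite \<Rightarrow> real"
  assumes M: "M \<in> sets lebesgue" and u: "\<And>i. weak_partial M u i (\<lambda>_. 0)"
    and AB: "cbox A B \<subseteq> M" "box A B \<noteq> {}"
  shows "\<exists>c. AE x in lebesgue. x \<in> cbox A B \<longrightarrow> u x = c"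
proof -
  have lu: "locally_integrable M u" using u by (simp add: weak_partial_def)
  have less: "A $ i < B $ i" for i using AB(2) by (auto simp: interval_ne_empty_cart)
  then have le: "A $ i \<le> B $ i" for i by (simp add: less_imp_le)
  have "\<forall>i. \<exists>\<eta>. smooth_on_ivl (A $ i) (B $ i) \<eta> \<and> integral {A $ i..B $ i} \<eta> = 1"
    using smooth_on_ivl_unit_integral[OF less] by metis
  then obtain \<eta> where \<eta>: "\<And>i. smooth_on_ivl (A $ i) (B $ i) (\<eta> i)" "\<And>i. integral {A $ i..B $ i} (\<eta> i) = 1"
    by metis
  define c where "c = (\<integral>x. u x * tensor \<eta> x \<partial>lebesgue_on M)"
  have "AE x in lebesgue. x \<in> cbox A B \<longrightarrow> u x = c"
  proof (rule AE_eq_on_cbox_if_box_integrals_eq)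
    show "set_integrable lebesgue (cbox A B) u"
      using lu AB(1) by (auto intro: locally_integrable_set_integrable)
    show "set_integrable lebesgue (cbox A B) (\<lambda>_. c)"
      by (rule absolutely_integrable_on_const) simp
    fix a b :: "real^'n" assume ab: "cbox a b \<subseteq> cbox A B" "box a b \<noteq> {}"
    then have ab': "a $ i < b $ i" for i by (auto simp: interval_ne_empty_cart)
    have sub: "A $ i \<le> a $ i" "b $ i \<le> B $ i" for i
      using ab(1) ab' by (auto simp: subset_interval_cart less_imp_le)
    have bumps: "smooth_on_ivl (A $ i) (B $ i) (bumps a b n i)" for i n
      using sub by (simp add: bumps_def smooth_on_ivl_bump)
    have "(\<lambda>n. \<integral>x. u x * tensor (bumps a b n) x \<partial>lebesgue_on M) \<longlonglongrightarrow> (LINT x:box a b|lebesgue. u x)"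
      using ab(1) AB(1) by (intro integral_tensor_bumps_tendsto[OF lu M]) auto
    moreover have "(\<integral>x. u x * tensor (bumps a b n) x \<partial>lebesgue_on M) =
        (\<Prod>i\<in>UNIV. integral {A $ i..B $ i} (bump (a $ i) (b $ i) n)) * c" for n
      unfolding c_def using integral_tensor_eq_prod[OF M u AB(1) le, of "bumps a b n" \<eta>] bumps \<eta> by (simp add: bumps_def)
    moreover have "(\<lambda>n. (\<Prod>i\<in>UNIV. integral {A $ i..B $ i} (bump (a $ i) (b $ i) n)) * c)
        \<longlonglongrightarrow> (\<Prod>i\<in>UNIV. b $ i - a $ i) * c"
      using sub ab' by (intro tendsto_intros integral_bump_tendsto) (auto simp: less_imp_le)
    ultimately have "(LINT x:box a b|lebesgue. u x) = (\<Prod>i\<in>UNIV. b $ i - a $ i) * c"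
      using LIMSEQ_unique by simp
    also have "(\<Prod>i\<in>UNIV. b $ i - a $ i) = measure lborel (cbox a b)"
      using ab(2) box_subset_cbox[of a b] by (intro content_cbox_cart[symmetric]) auto
    also have "\<dots> = measure lebesgue (box a b)"
      by (simp add: measure_def emeasure_lborel_box_eq emeasure_lborel_cbox_eq)
    finally show "(LINT x:box a b|lebesgue. u x) = (LINT x:box a b|lebesgue. c)"
      by (simp add: set_lebesgue_integral_def)
  qed
  then show ?thesis by blast
qed

lemma weak_gradient_zero_imp_constant:
  fixes u :: "real^'n::finite \<Rightarrow> real"
  assumes M: "open M" "connected M" and u: "\<And>i. weak_partial M u i (\<lambda>_. 0)"
  shows "\<exists>c. AE x in lebesgue_on M. u x = c"
proof -
  define P where "P y c \<longleftrightarrow> (\<exists>U. open U \<and> y \<in> U \<and> U \<subseteq> M \<and> (AE x in lebesgue. x \<in> U \<longrightarrow> u x = c))" for y c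
  define f where "f y = (THE c. P y c)" for y
  have cbox: "\<exists>c. AE x in lebesgue. x \<in> cbox a b \<longrightarrow> u x = c" if "cbox a b \<subseteq> M" "box a b \<noteq> {}" for a b
    using M(1) by (intro weak_gradient_zero_imp_constant_on_cbox[OF _ u that]) simp
  have ex: "\<exists>c. P y c" if "y \<in> M" for y
  proof -
    obtain a b where ab: "y \<in> box a b" "cbox a b \<subseteq> M"
      using M(1) \<open>y \<in> M\<close> open_contains_cbox by metis
    then obtain c where "AE x in lebesgue. x \<in> cbox a b \<longrightarrow> u x = c"
      using cbox by blast
    then have "AE x in lebesgue. x \<in> box a b \<longrightarrow> u x = c"
      by eventually_elim (use box_subset_cbox[of a b] in auto)
    with ab have "P y c"
      unfolding P_def using box_subset_cbox[of a b] by (intro exI[of _ "box a b"]) auto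
    then show ?thesis ..
  qed
  have uniq: "c = d" if c: "P y c" and d: "P y d" for y c d
  proof (rule ccontr)
    assume "c \<noteq> d"
    obtain U where U: "open U" "y \<in> U" "AE x in lebesgue. x \<in> U \<longrightarrow> u x = c"
      using c by (auto simp: P_def)
    obtain V where V: "open V" "y \<in> V" "AE x in lebesgue. x \<in> V \<longrightarrow> u x = d"
      using d by (auto simp: P_def)
    have "AE x in lebesgue. x \<notin> U \<inter> V"
      using U(3) V(3) by eventually_elim (use \<open>c \<noteq> d\<close> in auto)
    then have "negligible (U \<inter> V)"
      using U(1) V(1) by (simp add: negligible_iff_null_sets AE_iff_null_sets open_Int)
    moreover have "open (U \<inter> V)" "U \<inter> V \<noteq> {}" using U V by auto
    ultimately show False using open_not_negligible by blast
  qed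
  have f: "f y = c" if "P y c" for y c
    unfolding f_def using that uniq by (intro the_equality) auto
  have "f constant_on M"
  proof (rule locally_constant_imp_constant[OF M(2)])
    fix a assume "a \<in> M"
    then obtain c where "P a c" using ex by blast
    then obtain U where U: "open U" "a \<in> U" "U \<subseteq> M" "AE x in lebesgue. x \<in> U \<longrightarrow> u x = c"
      by (auto simp: P_def)
    then have "P x c" if "x \<in> U" for x using that by (auto simp: P_def)
    then have "\<forall>x\<in>U. f x = f a" using f U(2) by metis
    then show "\<exists>T. openin (top_of_set M) T \<and> a \<in> T \<and> (\<forall>x\<in>T. f x = f a)"
      using U open_openin_trans[OF M(1), of U] by blast
  qed
  then obtain c where c: "\<And>y. y \<in> M \<Longrightarrow> f y = c" by (auto simp: constant_on_def)
  have "AE x in lebesgue_on M. u x = c"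
  proof (rule AE_lebesgue_on_open_if_cbox[OF M(1)])
    fix a b assume ab: "cbox a b \<subseteq> M"
    show "AE x in lebesgue. x \<in> cbox a b \<longrightarrow> u x = c"
    proof (cases "box a b = {}")
      case True
      then have "negligible (cbox a b)" by (simp add: negligible_interval)
      then have "AE x in lebesgue. x \<notin> cbox a b"
        by (intro AE_not_in) (simp add: negligible_iff_null_sets)
      then show ?thesis by eventually_elim simp
    next
      case False
      then obtain d where d: "AE x in lebesgue. x \<in> cbox a b \<longrightarrow> u x = d"
        using cbox ab by blast
      obtain y where y: "y \<in> box a b" using False by blast
      have "AE x in lebesgue. x \<in> box a b \<longrightarrow> u x = d"
        using d by eventually_elim (use box_subset_cbox[of a b] in auto)
      with y ab have "P y d"
        unfolding P_def using box_subset_cbox[of a b] by (intro exI[of _ "box a b"]) auto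
      moreover have "y \<in> M" using y ab box_subset_cbox[of a b] by auto
      ultimately have "d = c" using f c by metis
      with d show ?thesis by simp
    qed
  qed
  then show ?thesis by blast
qed

lemma weak_partial_cong_AE:
  assumes M: "M \<in> sets lebesgue" and g: "weak_partial M u i g"
    and h: "locally_integrable M h" "AE x in lebesgue_on M. g x = h x"
  shows "weak_partial M u i h"
proof -
  have "(\<integral>x. g x * \<phi> x \<partial>lebesgue_on M) = (\<integral>x. h x * \<phi> x \<partial>lebesgue_on M)"
    if "\<phi> \<in> test_functions M" for \<phi>
  proof (rule integral_cong_AE)
    show "(\<lambda>x. g x * \<phi> x) \<in> borel_measurable (lebesgue_on M)" "(\<lambda>x. h x * \<phi> x) \<in> borel_measurable (lebesgue_on M)"
      using g h(1) M that by (auto simp: weak_partial_def intro: borel_measurable_integrable integrable_mult_test_function)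
    show "AE x in lebesgue_on M. g x * \<phi> x = h x * \<phi> x"
      using h(2) by eventually_elim simp
  qed
  then show ?thesis
    using g h(1) by (simp add: weak_partial_def)
qed

subsection \<open>Weak derivatives of constants\<close>

lemma test_function_has_derivative:
  assumes "\<phi> \<in> test_functions M"
  shows "(\<phi> has_derivative frechet_derivative \<phi> (at x)) (at x)"
  using test_functionD(1)[OF assms, of "Suc 0"] by (rule C_k_Suc_has_derivative)

lemma test_function_partial:
  assumes \<phi>: "\<phi> \<in> test_functions M" and v: "v \<in> Basis"
  shows "continuous_on UNIV (\<lambda>x. frechet_derivative \<phi> (at x) v)"
    and "x \<notin> closure {x. \<phi> x \<noteq> 0} \<Longrightarrow> frechet_derivative \<phi> (at x) v = 0"
proof -
  show "continuous_on UNIV (\<lambda>x. frechet_derivative \<phi> (at x) v)"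
    using test_functionD(1)[OF \<phi>, of "Suc 0"] v by simp
  assume x: "x \<notin> closure {x. \<phi> x \<noteq> 0}"
  have "((\<lambda>_. 0) has_derivative (\<lambda>_. 0)) (at x)" by simp
  then have "(\<phi> has_derivative (\<lambda>_. 0)) (at x)"
  proof (rule has_derivative_transform_within_open[where s="- closure {x. \<phi> x \<noteq> 0}"])
    show "0 = \<phi> y" if "y \<in> - closure {x. \<phi> x \<noteq> 0}" for y
      using test_functionD(5)[OF \<phi>, of y] that by (metis ComplD)
  qed (use x in \<open>simp_all add: open_Compl\<close>)
  then have "frechet_derivative \<phi> (at x) = (\<lambda>_. 0)"
    by (simp add: frechet_derivative_at[symmetric])
  then show "frechet_derivative \<phi> (at x) v = 0" by simp
qed

lemma integrable_lborel_compact_support: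
  fixes f :: "'a::euclidean_space \<Rightarrow> real"
  assumes "continuous_on UNIV f" "compact K" "\<And>x. x \<notin> K \<Longrightarrow> f x = 0"
  shows "integrable lborel f"
proof -
  have "integrable lborel (\<lambda>x. indicat_real K x *\<^sub>R f x)"
    using assms by (intro borel_integrable_compact) (auto intro: continuous_on_subset)
  also have "(\<lambda>x. indicat_real K x *\<^sub>R f x) = f"
    using assms(3) by (auto simp: fun_eq_iff indicator_def)
  finally show ?thesis .
qed

lemma integral_lborel_translation:
  fixes f :: "'a::euclidean_space \<Rightarrow> real"
  assumes "f \<in> borel_measurable borel"
  shows "(\<integral>x. f (c + x) \<partial>lborel) = (\<integral>x. f x \<partial>lborel)"
proof -
  have "(\<integral>x. f x \<partial>lborel) = (\<integral>x. f x \<partial>distr lborel borel ((+) c))"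
    by (simp only: lborel_distr_plus)
  also have "\<dots> = (\<integral>x. f (c + x) \<partial>lborel)"
    using assms by (intro integral_distr) simp_all
  finally show ?thesis ..
qed

lemma integral_partial_test_function:
  fixes \<phi> :: "'a::euclidean_space \<Rightarrow> real"
  assumes \<phi>: "\<phi> \<in> test_functions M" and v: "v \<in> Basis"
  shows "(\<integral>x. frechet_derivative \<phi> (at x) v \<partial>lborel) = 0"
proof -
  define K where "K = closure {x. \<phi> x \<noteq> 0}"
  define D where "D x = frechet_derivative \<phi> (at x) v" for x
  define q where "q n x = real (Suc n) * (\<phi> (inverse (real (Suc n)) *\<^sub>R v + x) - \<phi> x)" for n x
  have D: "continuous_on UNIV D" "\<And>x. x \<notin> K \<Longrightarrow> D x = 0"
    unfolding D_def K_def
    by (rule test_function_partial(1)[OF \<phi> v]) (rule test_function_partial(2)[OF \<phi> v])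
  have \<phi>0: "\<phi> x = 0" if "x \<notin> K" for x
    using that unfolding K_def by (rule test_functionD(5)[OF \<phi>])
  have [measurable]: "\<phi> \<in> borel_measurable borel" "D \<in> borel_measurable borel"
    using test_functionD(2)[OF \<phi>] D(1) by (auto intro: borel_measurable_continuous_onI)
  have i\<phi>: "integrable lborel \<phi>"
    by (rule integrable_lborel_compact_support[OF test_functionD(2,3)[OF \<phi>, folded K_def] \<phi>0])
  have line: "((\<lambda>t. \<phi> (t *\<^sub>R v + x)) has_real_derivative D (t *\<^sub>R v + x)) (at t)" for t x
  proof -
    have "((\<lambda>t. t *\<^sub>R v + x) has_derivative (\<lambda>h. h *\<^sub>R v)) (at t)"
      by (auto intro!: derivative_eq_intros)
    from diff_chain_at[OF this test_function_has_derivative[OF \<phi>]]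
    have "((\<lambda>t. \<phi> (t *\<^sub>R v + x)) has_derivative
        (\<lambda>h. frechet_derivative \<phi> (at (t *\<^sub>R v + x)) (h *\<^sub>R v))) (at t)"
      by (simp add: o_def)
    moreover have "linear (frechet_derivative \<phi> (at (t *\<^sub>R v + x)))"
      using test_function_has_derivative[OF \<phi>] by (rule has_derivative_linear)
    ultimately show ?thesis
      by (simp add: has_field_derivative_def D_def linear_scale mult_commute_abs)
  qed
  have "bounded (D ` K)"
    using D(1) test_functionD(3)[OF \<phi>, folded K_def]
    by (meson compact_continuous_image compact_imp_bounded continuous_on_subset subset_UNIV)
  then obtain C where C: "C > 0" "\<And>x. x \<in> K \<Longrightarrow> \<bar>D x\<bar> \<le> C"
    by (auto simp: bounded_pos)
  then have DC: "\<bar>D x\<bar> \<le> C" for x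
    using D(2)[of x] by (cases "x \<in> K") auto
  obtain R where R: "\<And>x. x \<in> K \<Longrightarrow> norm x \<le> R"
    using compact_imp_bounded[OF test_functionD(3)[OF \<phi>, folded K_def]] by (auto simp: bounded_iff)
  have h: "0 < inverse (real (Suc n))" "inverse (real (Suc n)) \<le> 1" for n
    by (simp_all add: field_simps)
  have "(\<lambda>n. \<integral>x. q n x \<partial>lborel) \<longlonglongrightarrow> (\<integral>x. D x \<partial>lborel)"
  proof (rule integral_dominated_convergence)
    show "integrable lborel (\<lambda>x. indicat_real (cball 0 (R + 1)) x *\<^sub>R C)"
      by (intro borel_integrable_compact) auto
    show "AE x in lborel. norm (q n x) \<le> indicat_real (cball 0 (R + 1)) x *\<^sub>R C" for n
    proof (rule AE_I2)
      fix x
      show "norm (q n x) \<le> indicat_real (cball 0 (R + 1)) x *\<^sub>R C"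
      proof (cases "x \<in> cball 0 (R + 1)")
        case True
        obtain z where "\<phi> (inverse (real (Suc n)) *\<^sub>R v + x) - \<phi> (0 *\<^sub>R v + x) =
            (inverse (real (Suc n)) - 0) * D (z *\<^sub>R v + x)"
          using MVT2[OF h(1) line] by blast
        then have "q n x = D (z *\<^sub>R v + x)"
          unfolding q_def by (simp del: of_nat_Suc)
        then show ?thesis using DC True by simp
      next
        case False
        then have "norm x > R + 1" by simp
        moreover have "norm (inverse (real (Suc n)) *\<^sub>R v + x) \<ge> norm x - 1"
          using norm_diff_ineq[of x "inverse (real (Suc n)) *\<^sub>R v"] h[of n] v
          by (simp add: add.commute del: of_nat_Suc)
        ultimately have "x \<notin> K" "inverse (real (Suc n)) *\<^sub>R v + x \<notin> K"
          using R[of x] R[of "inverse (real (Suc n)) *\<^sub>R v + x"] by fastforce+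
        then show ?thesis using False by (simp add: q_def \<phi>0)
      qed
    qed
    show "AE x in lborel. (\<lambda>n. q n x) \<longlonglongrightarrow> D x"
    proof (rule AE_I2)
      fix x
      have "((\<lambda>t. (\<phi> (t *\<^sub>R v + x) - \<phi> x) / t) \<longlongrightarrow> D x) (at 0)"
        using line[of x 0] by (simp add: DERIV_def)
      moreover have "filterlim (\<lambda>n. inverse (real (Suc n))) (at 0) sequentially"
        using LIMSEQ_inverse_real_of_nat by (auto simp: filterlim_at)
      ultimately have "(\<lambda>n. (\<phi> (inverse (real (Suc n)) *\<^sub>R v + x) - \<phi> x) / inverse (real (Suc n))) \<longlonglongrightarrow> D x"
        by (rule filterlim_compose)
      then show "(\<lambda>n. q n x) \<longlonglongrightarrow> D x"
        by (simp add: q_def divide_inverse mult.commute)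
    qed
  qed (auto simp: q_def)
  moreover have "(\<integral>x. q n x \<partial>lborel) = 0" for n
  proof -
    let ?c = "inverse (real (Suc n)) *\<^sub>R v"
    have "integrable lborel (\<lambda>x. \<phi> (?c + x))"
      using i\<phi> integrable_distr_eq[of "(+) ?c" lborel borel \<phi>] by (simp add: lborel_distr_plus)
    then show ?thesis
      unfolding q_def using i\<phi> by (simp add: integral_lborel_translation del: of_nat_Suc)
  qed
  ultimately show ?thesis
    by (simp add: D_def LIMSEQ_const_iff)
qed

lemma borel_measurable_lebesgue_on_cong_AE:
  fixes f g :: "'a::euclidean_space \<Rightarrow> real"
  assumes S: "S \<in> sets lebesgue" and "f \<in> borel_measurable (lebesgue_on S)" "AE x in lebesgue_on S. f x = g x"
  shows "g \<in> borel_measurable (lebesgue_on S)"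
proof -
  have "AE x in lebesgue. x \<in> S \<longrightarrow> f x = g x"
    using assms by (simp add: AE_restrict_space_iff)
  then have "AE x in lebesgue. (if x \<in> S then f x else 0) = (if x \<in> S then g x else 0)"
    by eventually_elim simp
  moreover have "(\<lambda>x. if x \<in> S then f x else 0) \<in> borel_measurable lebesgue"
    using assms by (simp add: borel_measurable_if)
  ultimately show ?thesis
    using borel_measurable_AE S by (simp add: borel_measurable_if[symmetric])
qed

lemma locally_integrable_cong_AE:
  assumes M: "M \<in> sets lebesgue" and f: "locally_integrable M f" and eq: "AE x in lebesgue_on M. f x = g x"
  shows "locally_integrable M g"
  unfolding locally_integrable_def
proof clarify
  fix K assume K: "compact K" "K \<subseteq> M"
  then have f: "integrable (lebesgue_on K) f"
    using f by (auto simp: locally_integrable_def)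
  have sK: "K \<in> sets lebesgue"
    using K(1) by (simp add: lmeasurable_compact fmeasurableD)
  have "AE x in lebesgue. x \<in> M \<longrightarrow> f x = g x"
    using eq M by (simp add: AE_restrict_space_iff)
  then have "AE x in lebesgue. x \<in> K \<longrightarrow> f x = g x"
    by eventually_elim (use K in auto)
  then have eq: "AE x in lebesgue_on K. f x = g x"
    using sK by (simp add: AE_restrict_space_iff)
  show "integrable (lebesgue_on K) g"
    using f borel_measurable_lebesgue_on_cong_AE[OF sK borel_measurable_integrable[OF f] eq] eq
    by (rule integrable_cong_AE_imp)
qed

lemma weak_partial_AE_const:
  fixes u :: "real^'n::finite \<Rightarrow> real"
  assumes M: "M \<in> sets lebesgue" and u: "AE x in lebesgue_on M. u x = c"
  shows "weak_partial M u i (\<lambda>_. 0)"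
proof -
  have c: "locally_integrable M (\<lambda>_. c)" for c
    unfolding locally_integrable_def
    by (auto simp: lmeasurable_compact intro!: finite_measure.integrable_const finite_measure_lebesgue_on)
  have lu: "locally_integrable M u"
    using u by (intro locally_integrable_cong_AE[OF M c[of c]]) (auto simp: eq_commute)
  have "(\<integral>x. u x * frechet_derivative \<phi> (at x) (axis i 1) \<partial>lebesgue_on M) = 0"
    if \<phi>: "\<phi> \<in> test_functions M" for \<phi>
  proof -
    let ?D = "\<lambda>x. frechet_derivative \<phi> (at x) (axis i 1)"
    have v: "axis i 1 \<in> (Basis :: (real^'n) set)" by (simp add: axis_in_Basis_iff)
    note D = test_function_partial[OF \<phi> v]
    have "(\<integral>x. u x * ?D x \<partial>lebesgue_on M) = (\<integral>x. c * ?D x \<partial>lebesgue_on M)"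
    proof (rule integral_cong_AE)
      show "(\<lambda>x. u x * ?D x) \<in> borel_measurable (lebesgue_on M)" "(\<lambda>x. c * ?D x) \<in> borel_measurable (lebesgue_on M)"
        by (intro borel_measurable_integrable integrable_mult_compact_support[OF _ M D(1) test_functionD(3,4)[OF \<phi>] D(2)] lu c;
            assumption)+
      show "AE x in lebesgue_on M. u x * ?D x = c * ?D x"
        using u by eventually_elim simp
    qed
    also have "\<dots> = (LINT x|lebesgue. indicat_real M x * (c * ?D x))"
      using M integral_restrict_space[of M lebesgue "\<lambda>x. c * ?D x"] by (simp only: sets.Int_space_eq2 real_scaleR_def)
    also have "(\<lambda>x. indicat_real M x * (c * ?D x)) = (\<lambda>x. c * ?D x)"
      using D(2) test_functionD(4)[OF \<phi>] by (force simp: indicator_def)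
    also have "(LINT x|lebesgue. c * ?D x) = (LINT x|lborel. c * ?D x)"
      using borel_measurable_continuous_onI[OF D(1)] by (intro integral_completion) simp
    also have "\<dots> = 0"
      by (simp add: integral_partial_test_function[OF \<phi> v])
    finally show ?thesis .
  qed
  then show ?thesis
    using lu c by (simp add: weak_partial_def)
qed

subsection \<open>The energy\<close>

lemma L2_cong_AE:
  fixes f g :: "'a::euclidean_space \<Rightarrow> real"
  assumes M: "M \<in> sets lebesgue" and f: "f \<in> L2 M" and eq: "AE x in lebesgue_on M. f x = g x"
  shows "g \<in> L2 M"
proof -
  have f: "f \<in> borel_measurable (lebesgue_on M)" "integrable (lebesgue_on M) (\<lambda>x. (f x)\<^sup>2)"
    using f by (auto simp: L2_def)
  have g: "g \<in> borel_measurable (lebesgue_on M)"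
    using borel_measurable_lebesgue_on_cong_AE[OF M f(1) eq] .
  have "integrable (lebesgue_on M) (\<lambda>x. (g x)\<^sup>2)"
  proof (rule integrable_cong_AE_imp[OF f(2)])
    show "(\<lambda>x. (g x)\<^sup>2) \<in> borel_measurable (lebesgue_on M)"
      using g by (rule borel_measurable_power)
    show "AE x in lebesgue_on M. (f x)\<^sup>2 = (g x)\<^sup>2"
      using eq by eventually_elim simp
  qed
  with g show ?thesis by (simp add: L2_def)
qed

lemma weak_jacobian_weak_D:
  assumes "S \<in> H1_vec M"
  shows "weak_jacobian M S (weak_D M S)"
proof -
  have "\<forall>j i. \<exists>g. weak_partial M (\<lambda>x. S x $ j) i g"
    using assms by (auto simp: H1_vec_def H1_def)
  then obtain g where "\<And>j i. weak_partial M (\<lambda>x. S x $ j) i (g j i)"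
    by metis
  then have "weak_jacobian M S (\<lambda>x. \<chi> j i. g j i x)"
    by (simp add: weak_jacobian_def)
  then show ?thesis
    unfolding weak_D_def by (rule someI[of "weak_jacobian M S"])
qed

lemma weak_D_L2:
  assumes "open M" "S \<in> H1_vec M"
  shows "(\<lambda>x. weak_D M S x $ j $ i) \<in> L2 M"
proof -
  obtain g where g: "g \<in> L2 M" "weak_partial M (\<lambda>x. S x $ j) i g"
    using assms(2) by (auto simp: H1_vec_def H1_def)
  have "weak_partial M (\<lambda>x. S x $ j) i (\<lambda>x. weak_D M S x $ j $ i)"
    using weak_jacobian_weak_D[OF assms(2)] by (simp add: weak_jacobian_def)
  from weak_partial_unique[OF assms(1) g(2) this] show ?thesis
    using assms(1) by (intro L2_cong_AE[OF _ g(1)]) auto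
qed

lemma power2_norm_vec: "(norm x)\<^sup>2 = (\<Sum>i\<in>UNIV. (x $ i)\<^sup>2)" for x :: "real^'n"
  unfolding power2_norm_eq_inner inner_vec_def by (simp add: power2_eq_square)

lemma power2_norm_matrix: "(norm G)\<^sup>2 = (\<Sum>j\<in>UNIV. \<Sum>i\<in>UNIV. (G $ j $ i)\<^sup>2)" for G :: "real^'n^'m"
  unfolding power2_norm_eq_inner inner_vec_def by (simp add: power2_eq_square)

lemma integrable_norm_weak_D:
  assumes "open M" "S \<in> H1_vec M"
  shows "integrable (lebesgue_on M) (\<lambda>x. (norm (weak_D M S x))\<^sup>2)"
  unfolding power2_norm_matrix using weak_D_L2[OF assms]
  by (intro Bochner_Integration.integrable_sum) (auto simp: L2_def)

lemma integrable_norm_H1_vec: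
  assumes "S \<in> H1_vec M"
  shows "integrable (lebesgue_on M) (\<lambda>x. (norm (S x))\<^sup>2)"
  unfolding power2_norm_vec using assms
  by (intro Bochner_Integration.integrable_sum) (auto simp: H1_vec_def H1_def L2_def)

lemma energy_density_integrable:
  assumes "open M" "S \<in> H1_vec M"
  shows "integrable (lebesgue_on M) (energy_density M \<alpha> S)"
  unfolding energy_density_def[abs_def] using integrable_norm_weak_D[OF assms] integrable_norm_H1_vec[OF assms(2)]
  by (intro Bochner_Integration.integrable_diff integrable_mult_right)

lemma prob_simplex_component_le_1:
  assumes "p \<in> prob_simplex"
  shows "p $ j \<le> 1"
proof -
  have "p $ j \<le> (\<Sum>j\<in>UNIV. p $ j)"
    using assms by (intro member_le_sum) (auto simp: prob_simplex_def)
  with assms show ?thesis by (simp add: prob_simplex_def)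
qed

lemma prob_simplex_norm_le_1:
  assumes "p \<in> prob_simplex"
  shows "(norm p)\<^sup>2 \<le> 1"
proof -
  have "(\<Sum>j\<in>UNIV. (p $ j)\<^sup>2) \<le> (\<Sum>j\<in>UNIV. p $ j)"
    using assms prob_simplex_component_le_1[OF assms]
    by (intro sum_mono) (auto simp: prob_simplex_def power2_eq_square intro: mult_left_le)
  with assms show ?thesis by (simp add: power2_norm_vec prob_simplex_def)
qed

lemma prob_simplex_norm_eq_1_iff:
  assumes "p \<in> prob_simplex"
  shows "(norm p)\<^sup>2 = 1 \<longleftrightarrow> (\<exists>j. p = axis j 1)"
proof
  assume 1: "(norm p)\<^sup>2 = 1"
  have nn: "\<And>j. p $ j \<ge> 0" and sum: "(\<Sum>j\<in>UNIV. p $ j) = 1"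
    using assms by (auto simp: prob_simplex_def)
  have nn': "p $ j * (1 - p $ j) \<ge> 0" for j
    using nn[of j] prob_simplex_component_le_1[OF assms, of j] by simp
  have "(\<Sum>j\<in>UNIV. p $ j * (1 - p $ j)) = (\<Sum>j\<in>UNIV. p $ j) - (norm p)\<^sup>2"
    unfolding power2_norm_vec sum_subtractf[symmetric]
    by (rule sum.cong) (auto simp: algebra_simps power2_eq_square)
  then have "\<forall>j\<in>UNIV. p $ j * (1 - p $ j) = 0"
    using 1 sum nn' by (subst sum_nonneg_eq_0_iff[symmetric]) auto
  then have 01: "p $ j = 0 \<or> p $ j = 1" for j by auto
  obtain j where j: "p $ j = 1"
    using 01 sum by (metis sum.neutral zero_neq_one)
  have "(\<Sum>k\<in>UNIV - {j}. p $ k) = 0"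
    using sum j by (simp add: sum.remove[of UNIV j])
  then have "p $ k = 0" if "k \<noteq> j" for k
    using nn that by (subst (asm) sum_nonneg_eq_0_iff) auto
  with j have "p = axis j 1" by (auto simp: vec_eq_iff axis_def)
  then show "\<exists>j. p = axis j 1" ..
qed (auto)

lemma axis_prob_simplex: "axis j 1 \<in> prob_simplex"
  by (auto simp: prob_simplex_def axis_def)

lemma AE_const_imp_D1:
  fixes S :: "real^'n::finite \<Rightarrow> real^'c::finite"
  assumes M: "open M" "bounded M" and p: "p \<in> prob_simplex" and S: "AE x in lebesgue_on M. S x = p"
  shows "S \<in> D1 M" and "AE x in lebesgue_on M. weak_D M S x = 0"
proof -
  have sM: "M \<in> sets lebesgue" and fin: "finite_measure (lebesgue_on M)"
    using M by (auto intro!: finite_measure_lebesgue_on simp: lmeasurable_open)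
  have Sj: "AE x in lebesgue_on M. S x $ j = p $ j" for j
    using S by eventually_elim simp
  have weak: "weak_partial M (\<lambda>x. S x $ j) i (\<lambda>_. 0)" for i j
    by (rule weak_partial_AE_const[OF sM Sj])
  have "(\<lambda>x. S x $ j) \<in> L2 M" for j
  proof (rule L2_cong_AE[OF sM])
    show "(\<lambda>_. p $ j) \<in> L2 M"
      using fin by (auto simp: L2_def intro: finite_measure.integrable_const)
    show "AE x in lebesgue_on M. p $ j = S x $ j"
      using Sj[of j] by eventually_elim simp
  qed
  moreover have "(\<lambda>_. 0) \<in> L2 M" by (simp add: L2_def)
  ultimately have H1: "S \<in> H1_vec M"
    using weak unfolding H1_vec_def H1_def by blast
  moreover have "AE x in lebesgue_on M. S x \<in> prob_simplex"
    using S by eventually_elim (simp add: p)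
  ultimately show "S \<in> D1 M" by (simp add: D1_def)
  have "AE x in lebesgue_on M. weak_D M S x $ j $ i = 0" for i j
  proof (rule weak_partial_unique[OF M(1) _ weak])
    show "weak_partial M (\<lambda>x. S x $ j) i (\<lambda>x. weak_D M S x $ j $ i)"
      using weak_jacobian_weak_D[OF H1] by (simp add: weak_jacobian_def)
  qed
  then have "AE x in lebesgue_on M. \<forall>j i. weak_D M S x $ j $ i = 0"
    by (simp add: AE_all_countable)
  then show "AE x in lebesgue_on M. weak_D M S x = 0"
    by eventually_elim (simp add: vec_eq_iff)
qed

lemma weak_D_zero_imp_AE_const:
  fixes S :: "real^'n::finite \<Rightarrow> real^'c::finite"
  assumes M: "open M" "connected M" and S: "S \<in> D1 M" and D: "AE x in lebesgue_on M. weak_D M S x = 0"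
  obtains p where "p \<in> prob_simplex" "AE x in lebesgue_on M. S x = p"
proof -
  have H1: "S \<in> H1_vec M" and simplex: "AE x in lebesgue_on M. S x \<in> prob_simplex"
    using S by (auto simp: D1_def)
  have sM: "M \<in> sets lebesgue" using M by simp
  have "weak_partial M (\<lambda>x. S x $ j) i (\<lambda>_. 0)" for i j
  proof (rule weak_partial_cong_AE[OF sM])
    show "weak_partial M (\<lambda>x. S x $ j) i (\<lambda>x. weak_D M S x $ j $ i)"
      using weak_jacobian_weak_D[OF H1] by (simp add: weak_jacobian_def)
    show "AE x in lebesgue_on M. weak_D M S x $ j $ i = 0"
      using D by eventually_elim simp
  qed (simp add: locally_integrable_def)
  then have "\<forall>j. \<exists>c. AE x in lebesgue_on M. S x $ j = c"
    using weak_gradient_zero_imp_constant[OF M] by blast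
  then obtain c where "\<And>j. AE x in lebesgue_on M. S x $ j = c j" by metis
  then have "AE x in lebesgue_on M. \<forall>j. S x $ j = c j"
    by (simp add: AE_all_countable)
  then have eq: "AE x in lebesgue_on M. S x = (\<chi> j. c j)"
    by eventually_elim (simp add: vec_eq_iff)
  show thesis
  proof (cases "M = {}")
    case True
    then have "AE x in lebesgue_on M. S x = axis (undefined :: 'c) 1"
      by (intro AE_I2) simp
    with axis_prob_simplex that show thesis by blast
  next
    case False
    have "AE x in lebesgue_on M. (\<chi> j. c j) \<in> (prob_simplex :: (real^'c) set)"
      using eq simplex by eventually_elim simp
    then have "(\<chi> j. c j) \<in> (prob_simplex :: (real^'c) set) \<or> (AE x in lebesgue. x \<notin> M)"
      using sM by (cases "(\<chi> j. c j) \<in> (prob_simplex :: (real^'c) set)") (auto simp: AE_restrict_space_iff)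
    moreover have "\<not> (AE x in lebesgue. x \<notin> M)"
      using M(1) False open_not_negligible[of M] sM by (simp add: negligible_iff_null_sets AE_iff_null_sets)
    ultimately show thesis using that eq by blast
  qed
qed

lemma energy_lower_bound:
  fixes S :: "real^'n::finite \<Rightarrow> real^'c::finite"
  assumes M: "open M" "bounded M" and \<alpha>: "\<alpha> \<ge> 0" and S: "S \<in> D1 M"
  shows "energy M \<alpha> S \<ge> - \<alpha> * measure lebesgue M"
    and "energy M \<alpha> S = - \<alpha> * measure lebesgue M \<longleftrightarrow>
      (AE x in lebesgue_on M. weak_D M S x = 0 \<and> (\<alpha> = 0 \<or> (norm (S x))\<^sup>2 = 1))"
proof -
  have sM: "M \<in> sets lebesgue" and fin: "finite_measure (lebesgue_on M)"
    using M by (auto intro!: finite_measure_lebesgue_on simp: lmeasurable_open)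
  have H1: "S \<in> H1_vec M" and simplex: "AE x in lebesgue_on M. S x \<in> prob_simplex"
    using S by (auto simp: D1_def)
  define f where "f x = energy_density M \<alpha> S x + \<alpha>" for x
  have f: "f x = (norm (weak_D M S x))\<^sup>2 + \<alpha> * (1 - (norm (S x))\<^sup>2)" for x
    by (simp add: f_def energy_density_def algebra_simps)
  have int: "integrable (lebesgue_on M) f"
    unfolding f_def using energy_density_integrable[OF M(1) H1] fin
    by (intro Bochner_Integration.integrable_add finite_measure.integrable_const)
  have nonneg: "AE x in lebesgue_on M. 0 \<le> f x"
    using simplex
  proof eventually_elim
    case (elim x)
    then show ?case
      unfolding f using \<alpha> prob_simplex_norm_le_1[of "S x"]
      by (intro add_nonneg_nonneg mult_nonneg_nonneg) auto
  qed
  have "(\<integral>x. f x \<partial>lebesgue_on M) = energy M \<alpha> S + (\<integral>x. \<alpha> \<partial>lebesgue_on M)"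
    unfolding f_def energy_def using energy_density_integrable[OF M(1) H1] fin
    by (intro Bochner_Integration.integral_add finite_measure.integrable_const)
  also have "(\<integral>x. \<alpha> \<partial>lebesgue_on M) = \<alpha> * measure lebesgue M"
    using sM by (simp add: measure_restrict_space)
  finally have E: "energy M \<alpha> S = (\<integral>x. f x \<partial>lebesgue_on M) - \<alpha> * measure lebesgue M"
    by simp
  then show "energy M \<alpha> S \<ge> - \<alpha> * measure lebesgue M"
    using integral_nonneg_AE[OF nonneg] by simp
  have "energy M \<alpha> S = - \<alpha> * measure lebesgue M \<longleftrightarrow> (AE x in lebesgue_on M. f x = 0)"
    using integral_nonneg_eq_0_iff_AE[OF int nonneg] E by simp
  also have "\<dots> \<longleftrightarrow> (AE x in lebesgue_on M. weak_D M S x = 0 \<and> (\<alpha> = 0 \<or> (norm (S x))\<^sup>2 = 1))"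
  proof (rule eventually_cong[OF simplex])
    fix x assume "S x \<in> prob_simplex"
    then have "\<alpha> * (1 - (norm (S x))\<^sup>2) \<ge> 0"
      using \<alpha> prob_simplex_norm_le_1[of "S x"] by simp
    then show "f x = 0 \<longleftrightarrow> weak_D M S x = 0 \<and> (\<alpha> = 0 \<or> (norm (S x))\<^sup>2 = 1)"
      unfolding f by (subst add_nonneg_eq_0_iff) auto
  qed
  finally show "energy M \<alpha> S = - \<alpha> * measure lebesgue M \<longleftrightarrow>
      (AE x in lebesgue_on M. weak_D M S x = 0 \<and> (\<alpha> = 0 \<or> (norm (S x))\<^sup>2 = 1))" .
qed

lemma energy_minimal_iff:
  fixes S :: "real^'n::finite \<Rightarrow> real^'c::finite"
  assumes M: "open M" "bounded M" "connected M" and \<alpha>: "\<alpha> \<ge> 0"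
  shows "S \<in> D1 M \<and> energy M \<alpha> S = - \<alpha> * measure lebesgue M \<longleftrightarrow>
    (\<exists>p\<in>prob_simplex. (\<alpha> = 0 \<or> (\<exists>j. p = axis j 1)) \<and> (AE x in lebesgue_on M. S x = p))"
    (is "?L \<longleftrightarrow> ?R")
proof
  assume ?L
  then have S: "S \<in> D1 M" and AE: "AE x in lebesgue_on M. weak_D M S x = 0 \<and> (\<alpha> = 0 \<or> (norm (S x))\<^sup>2 = 1)"
    using energy_lower_bound(2)[OF M(1,2) \<alpha>] by auto
  then have "AE x in lebesgue_on M. weak_D M S x = 0" by auto
  then obtain p where p: "p \<in> prob_simplex" "AE x in lebesgue_on M. S x = p"
    using weak_D_zero_imp_AE_const[OF M(1,3) S] by metis
  show ?R
  proof (cases "\<alpha> = 0 \<or> (\<exists>j. p = axis j 1)")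
    case False
    then have "(norm p)\<^sup>2 \<noteq> 1" using prob_simplex_norm_eq_1_iff[OF p(1)] by simp
    have "AE x in lebesgue_on M. False"
      using AE p(2) by eventually_elim (use False \<open>(norm p)\<^sup>2 \<noteq> 1\<close> in auto)
    then have "AE x in lebesgue_on M. S x = axis (undefined :: 'c) 1" by eventually_elim simp
    then show ?thesis using axis_prob_simplex by blast
  qed (use p in blast)
next
  assume ?R
  then obtain p where p: "p \<in> prob_simplex" "\<alpha> = 0 \<or> (\<exists>j. p = axis j 1)" "AE x in lebesgue_on M. S x = p"
    by blast
  note const = AE_const_imp_D1[OF M(1,2) p(1,3)]
  have "AE x in lebesgue_on M. weak_D M S x = 0 \<and> (\<alpha> = 0 \<or> (norm (S x))\<^sup>2 = 1)"
    using const(2) p(3) by eventually_elim (use p(2) in auto)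
  then show ?L
    using const(1) energy_lower_bound(2)[OF M(1,2) \<alpha> const(1)] by simp
qed

theorem proposition4p2:
  fixes M :: "(real^2) set" and \<alpha> :: real
  assumes "open M" and "bounded M" and "simply_connected M"
    and "CARD('c::finite) \<ge> 2"
    and "\<alpha> \<ge> 0"
  shows "(\<forall>S\<in>(D1 M :: (real^2 \<Rightarrow> real^'c) set). integrable (lebesgue_on M) (energy_density M \<alpha> S))
    \<and> bdd_below (energy M \<alpha> ` (D1 M :: (real^2 \<Rightarrow> real^'c) set))
    \<and> (\<forall>S\<in>(D1 M :: (real^2 \<Rightarrow> real^'c) set). energy M \<alpha> S \<ge> - \<alpha> * measure lebesgue M)
    \<and> (\<exists>S\<in>(D1 M :: (real^2 \<Rightarrow> real^'c) set). energy M \<alpha> S = - \<alpha> * measure lebesgue M)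
    \<and> {S :: real^2 \<Rightarrow> real^'c. is_arg_min (energy M \<alpha>) (\<lambda>S. S \<in> D1 M) S} =
        (if \<alpha> > 0 then (\<Union>j. ae_class M (\<lambda>x. axis j 1))
         else (\<Union>p\<in>prob_simplex. ae_class M (\<lambda>x. p)))"
proof -
  have con: "connected M"
    using assms(3) by (rule simply_connected_imp_connected)
  note min = energy_minimal_iff[OF assms(1,2) con assms(5), where 'c='c]
  note lower = energy_lower_bound(1)[OF assms(1,2,5), where 'c='c]
  define S0 :: "real^2 \<Rightarrow> real^'c" where "S0 = (\<lambda>_. axis undefined 1)"
  have "AE x in lebesgue_on M. S0 x = axis undefined 1" by (simp add: S0_def)
  then have S0: "S0 \<in> D1 M" "energy M \<alpha> S0 = - \<alpha> * measure lebesgue M"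
    using min[of S0] axis_prob_simplex by blast+
  have "is_arg_min (energy M \<alpha>) (\<lambda>S. S \<in> D1 M) S \<longleftrightarrow>
      S \<in> D1 M \<and> energy M \<alpha> S = - \<alpha> * measure lebesgue M" for S :: "real^2 \<Rightarrow> real^'c"
    unfolding is_arg_min_def using S0 lower by (metis less_le not_less)
  then have "{S :: real^2 \<Rightarrow> real^'c. is_arg_min (energy M \<alpha>) (\<lambda>S. S \<in> D1 M) S} =
      {S. \<exists>p\<in>prob_simplex. (\<alpha> = 0 \<or> (\<exists>j. p = axis j 1)) \<and> (AE x in lebesgue_on M. S x = p)}"
    by (simp only: min)
  also have "\<dots> = (if \<alpha> > 0 then (\<Union>j. ae_class M (\<lambda>x. axis j 1))
      else (\<Union>p\<in>prob_simplex. ae_class M (\<lambda>x. p)))"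
    using assms(5) axis_prob_simplex by (auto simp: ae_class_def)
  finally have argmin: "{S :: real^2 \<Rightarrow> real^'c. is_arg_min (energy M \<alpha>) (\<lambda>S. S \<in> D1 M) S} =
      (if \<alpha> > 0 then (\<Union>j. ae_class M (\<lambda>x. axis j 1))
       else (\<Union>p\<in>prob_simplex. ae_class M (\<lambda>x. p)))" .
  show ?thesis
  proof (intro conjI argmin ballI)
    show "integrable (lebesgue_on M) (energy_density M \<alpha> S)" if "S \<in> D1 M" for S :: "real^2 \<Rightarrow> real^'c"
      using that energy_density_integrable[OF assms(1)] by (auto simp: D1_def)
    show "bdd_below (energy M \<alpha> ` (D1 M :: (real^2 \<Rightarrow> real^'c) set))"
      using lower by (intro bdd_belowI2)
    show "\<exists>S\<in>(D1 M :: (real^2 \<Rightarrow> real^'c) set). energy M \<alpha> S = - \<alpha> * measure lebesgue M"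
      using S0 by blast
  qed (rule lower)
qed

end
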